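(* Assume (H1) (for $|p|\le K$, the maps $p\mapsto H(x,p)$ and $p\mapsto\alpha^*(x,p)$ are Lipschitz continuous) and that the Master Equation (M) admits a unique regular solution $U$. Fix $N\ge 2$, $(t_0,m_0)\in[0,T]\times P(\Sigma)$, $\bm{x}=(x_1,\dots,x_N)\in\Sigma^N$, and let $(v^{N,i})_{i=1,\dots,N}$ be the solution to the system (HJB). For $i\in\{1,\dots,N\}$ and $x\in\Sigma$ set $$w^{N,i}(t_0,x,m_0):=\sum_{x_1=1}^d\cdots\sum_{x_{i-1}=1}^d\ \sum_{x_{i+1}=1}^d\cdots\sum_{x_N=1}^d v^{N,i}(t_0,x_1,\dots,x_{i-1},x,x_{i+1},\dots,x_N)\prod_{j\ne i}m_0(x_j),$$ $$\|w^{N,i}(t_0,\cdot,m_0)-U(t_0,\cdot,m_0)\|_{L^1(m_0)}:=\sum_{x=1}^d|w^{N,i}(t_0,x,m_0)-U(t_0,x,m_0)|\,m_0(x).$$ Then $$\frac1N\sum_{i=1}^N|v^{N,i}(t_0,\bm{x})-U(t_0,x_i,m^N_{\bm{x}})|\le\frac CN,\qquad \|w^{N,i}(t_0,\cdot,m_0)-U(t_0,\cdot,m_0)\|_{L^1(m_0)}\le\frac{C}{\sqrt N}\quad(i=1,\dots,N),$$ where the constant $C$ does not depend on $i,t_0,m_0,\bm{x}$ nor $N$.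
   Context: **Basic notation.** $\Sigma=\{1,\dots,d\}$, $T>0$, $0<\kappa<M$, $A=[\kappa,M]^d$, $P(\Sigma)=\{m\in\mathbb R^d: m_j\ge0,\ m_1+\dots+m_d=1\}$ (we write $m(x)=m_x$); $|\cdot|$ is the Euclidean norm. $L:\Sigma\times A\to\mathbb R$ is continuous in its second argument, $H(x,p):=\sup_{\alpha\in A}\{-\alpha\cdot p-L(x,\alpha)\}$ for $x\in\Sigma$, $p\in\mathbb R^d$, and the maximizer is assumed unique for every $(x,p)$ and denoted $\alpha^*(x,p)\in A$. Running and terminal costs are functions $F,G:\Sigma\times P(\Sigma)\to\mathbb R$. **Finite differences.** For $g:\Sigma\to\mathbb R$, $\Delta g(x):=(g(1)-g(x),\dots,g(d)-g(x))\in\mathbb R^d$; for $g:\Sigma^N\to\mathbb R$, $\Delta^jg(\bm{x})\in\mathbb R^d$ has $y$-th component $g(x_1,\dots,x_{j-1},y,x_{j+1},\dots,x_N)-g(\bm{x})$; for a function $U(t,x,m)$, $\Delta^xU(t,x,m)$ is the finite difference in $x$, i.e. $(U(t,y,m)-U(t,x,m))_{y=1,\dots,d}$. **Empirical measures.** $m^N_{\bm{x}}=\frac1N\sum_{j=1}^N\delta_{x_j}$, $m^{N,i}_{\bm{x}}=\frac1{N-1}\sum_{j\ne i}\delta_{x_j}$. **(HJB) with mean-field costs.** For $i=1,\dots,N$, $t\in[0,T]$, $\bm{x}\in\Sigma^N$: $$-\frac{\partial v^{N,i}}{\partial t}(t,\bm{x})-\sum_{j\ne i}\alpha^*(x_j,\Delta^jv^{N,j}(t,\bm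 x))\cdot\Delta^jv^{N,i}(t,\bm x)+H(x_i,\Delta^iv^{N,i}(t,\bm x))=F(x_i,m^{N,i}_{\bm{x}}),\quad v^{N,i}(T,\bm{x})=G(x_i,m^{N,i}_{\bm{x}}).$$ **Derivatives on the simplex.** $U:P(\Sigma)\to\mathbb R$ is differentiable if there is $D^mU:P(\Sigma)\times\Sigma\to\mathbb R^d$ with $[D^mU(m,y)]_z=\lim_{s\to0^+}\frac{U(m+s(\delta_z-\delta_y))-U(m)}{s}$, $z=1,\dots,d$ (at boundary points only admissible directions are considered). $U$ is $C^1$ if $D^mU$ is continuous in $m$. **Master Equation (M).** For $U:[0,T]\times\Sigma\times P(\Sigma)\to\mathbb R$: $$-\frac{\partial U}{\partial t}+H(x,\Delta^xU)-\int_\Sigma D^mU(t,x,m,y)\cdot\alpha^*(y,\Delta^yU(t,y,m))\,dm(y)=F(x,m),\qquad U(T,x,m)=G(x,m).$$ A classical solution is a function $U$, continuous in all arguments, $C^1$ in $t$ and $C^1$ in $m$, satisfying (M) at every $(t,x,m)\in[0,T]\times\Sigma\times P(\Sigma)$ (in particular $\Delta^xU(t,x,\cdot)$ is bounded and Lipschitz and $D^mU(t,x,\cdot)$ is bounded). A regular solution is a classical solution for which $D^mU(t,x,\cdot)$ is moreover Lipschitz continuous in $m$, uniformly in $(t,x)$. **The constant $K$.** $K>0$ is a fixed constant, large enough that the finite differences at which $H$ and $\alpha^*$ are evaluated (the $\Delta^iv^{N,i}(t,\bm{x})$, which are bounded uniformly in $N,i,t,\bm{x}$, and $\Delta^xU$)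 have norm at most $K$. *)

theory Defs
  imports "HOL-Analysis.Analysis"
begin

text \<open>The state space \<open>\<Sigma>\<close> of \<open>d\<close> elements is an arbitrary finite type \<open>'d\<close>, so that \<open>\<real>\<^sup>d\<close> is
  \<open>real ^ 'd\<close> and the Dirac mass at \<open>x\<close> is \<open>axis x 1\<close>. The number of players \<open>N\<close> varies, so that
  \<open>\<Sigma>\<^sup>N\<close> is a set of extensional functions on \<open>{1..N}\<close>.\<close>

definition prob_simplex :: "(real ^ 'd::finite) set" where
  "prob_simplex = {m. (\<forall>j. 0 \<le> m $ j) \<and> (\<Sum>j\<in>UNIV. m $ j) = 1}"

definition configs :: "nat \<Rightarrow> (nat \<Rightarrow> 'd::finite) set" where
  "configs N = {1..N} \<rightarrow>\<^sub>E UNIV"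

definition control_set :: "real \<Rightarrow> real \<Rightarrow> (real ^ 'd::finite) set" where
  "control_set \<kappa> M = {a. \<forall>j. \<kappa> \<le> a $ j \<and> a $ j \<le> M}"

definition hamiltonian ::
  "(real ^ 'd::finite) set \<Rightarrow> ('d \<Rightarrow> real ^ 'd \<Rightarrow> real) \<Rightarrow> 'd \<Rightarrow> real ^ 'd \<Rightarrow> real" where
  "hamiltonian A L x p = (SUP a\<in>A. - (a \<bullet> p) - L x a)"

definition is_maximizer ::
  "(real ^ 'd::finite) set \<Rightarrow> ('d \<Rightarrow> real ^ 'd \<Rightarrow> real) \<Rightarrow> 'd \<Rightarrow> real ^ 'd \<Rightarrow> real ^ 'd \<Rightarrow> bool" where
  "is_maximizer A L x p a \<longleftrightarrow> a \<in> A \<and> - (a \<bullet> p) - L x a = hamiltonian A L x p"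

definition opt_control ::
  "(real ^ 'd::finite) set \<Rightarrow> ('d \<Rightarrow> real ^ 'd \<Rightarrow> real) \<Rightarrow> 'd \<Rightarrow> real ^ 'd \<Rightarrow> real ^ 'd" where
  "opt_control A L x p = (THE a. is_maximizer A L x p a)"

definition fin_diff :: "('d::finite \<Rightarrow> real) \<Rightarrow> 'd \<Rightarrow> real ^ 'd" where
  "fin_diff g x = (\<chi> y. g y - g x)"

definition fin_diff_at :: "nat \<Rightarrow> ((nat \<Rightarrow> 'd::finite) \<Rightarrow> real) \<Rightarrow> (nat \<Rightarrow> 'd) \<Rightarrow> real ^ 'd" where
  "fin_diff_at j g x = (\<chi> y. g (x(j := y)) - g x)"

definition emp_measure :: "nat \<Rightarrow> (nat \<Rightarrow> 'd::finite) \<Rightarrow> real ^ 'd" where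
  "emp_measure N x = (1 / real N) *\<^sub>R (\<Sum>j\<in>{1..N}. axis (x j) 1)"

definition emp_measure_except :: "nat \<Rightarrow> nat \<Rightarrow> (nat \<Rightarrow> 'd::finite) \<Rightarrow> real ^ 'd" where
  "emp_measure_except N i x = (1 / (real N - 1)) *\<^sub>R (\<Sum>j\<in>{1..N} - {i}. axis (x j) 1)"

text \<open>\<open>v i t x\<close> is \<open>v\<^sup>N\<^sup>,\<^sup>i(t, x)\<close>. Time derivatives at the endpoints of \<open>[0,T]\<close> are one-sided.\<close>

definition hjb_solution ::
  "(real ^ 'd::finite) set \<Rightarrow> ('d \<Rightarrow> real ^ 'd \<Rightarrow> real) \<Rightarrow> real \<Rightarrow> ('d \<Rightarrow> real ^ 'd \<Rightarrow> real)
    \<Rightarrow> ('d \<Rightarrow> real ^ 'd \<Rightarrow> real) \<Rightarrow> nat \<Rightarrow> (nat \<Rightarrow> real \<Rightarrow> (nat \<Rightarrow> 'd) \<Rightarrow> real) \<Rightarrow> bool" where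
  "hjb_solution A L T F G N v \<longleftrightarrow>
    (\<forall>i\<in>{1..N}. \<forall>x\<in>configs N.
      (\<forall>t\<in>{0..T}. \<exists>v'.
        ((\<lambda>s. v i s x) has_real_derivative v') (at t within {0..T}) \<and>
        - v'
        - (\<Sum>j\<in>{1..N} - {i}.
            opt_control A L (x j) (fin_diff_at j (v j t) x) \<bullet> fin_diff_at j (v i t) x)
        + hamiltonian A L (x i) (fin_diff_at i (v i t) x)
        = F (x i) (emp_measure_except N i x)) \<and>
      v i T x = G (x i) (emp_measure_except N i x))"

text \<open>\<open>D m y $ z\<close> is the derivative of \<open>U\<close> at \<open>m\<close> in the direction \<open>\<delta>\<^sub>z - \<delta>\<^sub>y\<close>, required only when that
  direction points into the simplex. The remaining values of \<open>D\<close> at boundary points are determined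
  by the continuity of \<open>D\<close>, so a \<open>C\<^sup>1\<close> function has only one continuous \<open>D\<close> on the simplex.\<close>

definition has_simplex_deriv ::
  "(real ^ 'd::finite \<Rightarrow> real) \<Rightarrow> (real ^ 'd \<Rightarrow> 'd \<Rightarrow> real ^ 'd) \<Rightarrow> bool" where
  "has_simplex_deriv U D \<longleftrightarrow>
    (\<forall>m\<in>prob_simplex. \<forall>y z.
      (\<forall>\<^sub>F s in at_right 0. m + s *\<^sub>R (axis z 1 - axis y 1) \<in> prob_simplex) \<longrightarrow>
      ((\<lambda>s. (U (m + s *\<^sub>R (axis z 1 - axis y 1)) - U m) / s) \<longlongrightarrow> D m y $ z) (at_right 0))"

text \<open>\<open>D t x m y\<close> is \<open>D\<^sup>mU(t, x, m, y)\<close>.\<close>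

definition classical_master_solution ::
  "(real ^ 'd::finite) set \<Rightarrow> ('d \<Rightarrow> real ^ 'd \<Rightarrow> real) \<Rightarrow> real \<Rightarrow> ('d \<Rightarrow> real ^ 'd \<Rightarrow> real)
    \<Rightarrow> ('d \<Rightarrow> real ^ 'd \<Rightarrow> real) \<Rightarrow> (real \<Rightarrow> 'd \<Rightarrow> real ^ 'd \<Rightarrow> real)
    \<Rightarrow> (real \<Rightarrow> 'd \<Rightarrow> real ^ 'd \<Rightarrow> 'd \<Rightarrow> real ^ 'd) \<Rightarrow> bool" where
  "classical_master_solution A L T F G U D \<longleftrightarrow>
    (\<forall>x. continuous_on ({0..T} \<times> prob_simplex) (\<lambda>(t, m). U t x m)) \<and>
    (\<forall>t\<in>{0..T}. \<forall>x. has_simplex_deriv (U t x) (D t x) \<and>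
      (\<forall>y. continuous_on prob_simplex (\<lambda>m. D t x m y))) \<and>
    (\<exists>Ut.
      (\<forall>x. \<forall>m\<in>prob_simplex. continuous_on {0..T} (\<lambda>t. Ut t x m)) \<and>
      (\<forall>t\<in>{0..T}. \<forall>x. \<forall>m\<in>prob_simplex.
        ((\<lambda>s. U s x m) has_real_derivative Ut t x m) (at t within {0..T}) \<and>
        - Ut t x m + hamiltonian A L x (fin_diff (\<lambda>y. U t y m) x)
        - (\<Sum>y\<in>UNIV. (D t x m y \<bullet> opt_control A L y (fin_diff (\<lambda>y'. U t y' m) y)) * m $ y)
        = F x m)) \<and>
    (\<forall>x. \<forall>m\<in>prob_simplex. U T x m = G x m)"

definition regular_master_solution ::
  "(real ^ 'd::finite) set \<Rightarrow> ('d \<Rightarrow> real ^ 'd \<Rightarrow> real) \<Rightarrow> real \<Rightarrow> ('d \<Rightarrow> real ^ 'd \<Rightarrow> real)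
    \<Rightarrow> ('d \<Rightarrow> real ^ 'd \<Rightarrow> real) \<Rightarrow> (real \<Rightarrow> 'd \<Rightarrow> real ^ 'd \<Rightarrow> real) \<Rightarrow> bool" where
  "regular_master_solution A L T F G U \<longleftrightarrow>
    (\<exists>D. classical_master_solution A L T F G U D \<and>
      (\<exists>B. \<forall>t\<in>{0..T}. \<forall>x y. B-lipschitz_on prob_simplex (\<lambda>m. D t x m y)))"

text \<open>\<open>\<xi>\<close> ranges over the states of the players other than \<open>i\<close>.\<close>

definition w_average ::
  "nat \<Rightarrow> (nat \<Rightarrow> real \<Rightarrow> (nat \<Rightarrow> 'd::finite) \<Rightarrow> real) \<Rightarrow> nat \<Rightarrow> real \<Rightarrow> 'd \<Rightarrow> real ^ 'd \<Rightarrow> real" where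
  "w_average N v i t x m =
    (\<Sum>\<xi>\<in>({1..N} - {i}) \<rightarrow>\<^sub>E UNIV. v i t (\<xi>(i := x)) * (\<Prod>j\<in>{1..N} - {i}. m $ \<xi> j))"

definition L1_dist :: "real ^ 'd::finite \<Rightarrow> ('d \<Rightarrow> real) \<Rightarrow> ('d \<Rightarrow> real) \<Rightarrow> real" where
  "L1_dist m f g = (\<Sum>x\<in>UNIV. \<bar>f x - g x\<bar> * m $ x)"

end

theory Submission
  imports Defs
begin

text \<open>
  The solution of the Master Equation, evaluated at the empirical measure of the other players,
  \<open>u\<^sup>i(t, x) = U(t, x\<^sub>i, m\<^sup>N\<^sup>,\<^sup>i)\<close>, solves the \<open>N\<close>-player system up to an error of order \<open>1 / N\<close>: a jump
  of one player moves a mass \<open>1 / (N - 1)\<close>, so by the Lipschitz continuity of \<open>D\<^sup>mU\<close> the increments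
  of \<open>u\<^sup>i\<close> are given by \<open>D\<^sup>mU\<close> up to order \<open>1 / N\<^sup>2\<close> (\<open>transfer_expansion\<close>), and the sum over the
  players becomes the integral of the Master Equation (\<open>interaction_term_le\<close>).

  The difference \<open>e\<^sup>i = v\<^sup>i - u\<^sup>i\<close> vanishes at time \<open>T\<close> and satisfies a linear backward equation
  \<open>- \<partial>\<^sub>t e\<^sup>i = \<Sum>\<^sub>j \<alpha>\<^sup>j \<cdot> \<Delta>\<^sup>j e\<^sup>i + O(max \<bar>e\<bar> + 1 / N)\<close> (\<open>error_equation\<close>). Here the nonlinearity is
  harmless: the change of the control of player \<open>j\<close> is of the order of \<open>\<Delta>\<^sup>j e\<^sup>j\<close>, and it multiplies
  \<open>\<Delta>\<^sup>j u\<^sup>i = O(1 / N)\<close>. As there are finitely many players and configurations, the maximum of \<open>\<bar>e\<bar>\<close> is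
  attained, and there the jump term has the good sign because jump rates are nonnegative. So the
  maximum satisfies a Gronwall inequality, and \<open>\<bar>e\<bar> = O(1 / N)\<close> uniformly
  (\<open>backward_comparison\<close>, \<open>hjb_close_to_mf_value\<close>). Replacing \<open>m\<^sup>N\<^sup>,\<^sup>i\<close> by \<open>m\<^sup>N\<close> costs another
  \<open>O(1 / N)\<close> by the Lipschitz continuity of \<open>U\<close> in the measure, which gives the first estimate.

  For the second one, the values are averaged over independent states of law \<open>m\<^sub>0\<close>; the mean distance
  between their empirical measure and \<open>m\<^sub>0\<close> is \<open>O(1 / sqrt N)\<close> by a variance computation
  (\<open>expected_empirical_distance\<close>).
\<close>

section \<open>Backward comparison for finite families\<close>

text \<open>The common core of the mean value inequality and of the maximum principle below: followed backwards
from \<open>b\<close>, a finite family of negative continuous functions stays negative if none of them can be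
the first to reach zero. If the set of times at which some member is nonnegative is nonempty, it is
compact and has a last element, where some member attains the maximum \<open>0\<close> of the family; the
hypothesis \<open>step\<close> then produces a later element of the same set.\<close>

lemma family_negative_backward:
  fixes g :: "'k \<Rightarrow> real \<Rightarrow> real"
  assumes fin: "finite I"
    and cont: "\<And>k. k \<in> I \<Longrightarrow> continuous_on {a..b} (g k)"
    and final: "\<And>k. k \<in> I \<Longrightarrow> g k b < 0"
    and step: "\<And>k t. \<lbrakk>k \<in> I; a \<le> t; t < b; g k t = 0; \<And>l. l \<in> I \<Longrightarrow> g l t \<le> 0\<rbrakk>
      \<Longrightarrow> \<exists>s>t. s \<le> b \<and> 0 \<le> g k s"
    and k: "k \<in> I" and t: "t \<in> {a..b}"
  shows "g k t < 0"
proof (rule ccontr)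
  assume neg: "\<not> g k t < 0"
  define S where "S = (\<Union>l\<in>I. {s\<in>{a..b}. 0 \<le> g l s})"
  have "compact {s\<in>{a..b}. 0 \<le> g l s}" if "l \<in> I" for l
  proof -
    have "closed ({a..b} \<inter> g l -` {0..})"
      by (rule continuous_closed_preimage[OF cont[OF that]]) auto
    moreover have "{a..b} \<inter> g l -` {0..} = {s\<in>{a..b}. 0 \<le> g l s}" by auto
    ultimately have "compact ({a..b} \<inter> {s\<in>{a..b}. 0 \<le> g l s})"
      by (intro compact_Int_closed) auto
    moreover have "{a..b} \<inter> {s\<in>{a..b}. 0 \<le> g l s} = {s\<in>{a..b}. 0 \<le> g l s}" by auto
    ultimately show ?thesis by simp
  qed
  then have "compact S" unfolding S_def by (intro compact_UN fin) auto
  moreover have "t \<in> S" using neg k t by (auto simp: S_def not_less)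
  ultimately obtain r where r: "r \<in> S" and last: "\<And>s. s \<in> S \<Longrightarrow> s \<le> r"
    using compact_attains_sup[of S] by blast
  from r obtain l where l: "l \<in> I" "a \<le> r" "r \<le> b" "0 \<le> g l r" by (auto simp: S_def)
  have "r < b" using l final[of l] by (cases "r = b") auto
  have nonpos: "g l' r \<le> 0" if l': "l' \<in> I" for l'
  proof (rule ccontr)
    assume "\<not> g l' r \<le> 0"
    moreover have "continuous_on {r..b} (g l')"
      by (rule continuous_on_subset[OF cont[OF l']]) (use l(2) in auto)
    ultimately obtain s where "r \<le> s" "s \<le> b" "g l' s = 0"
      using IVT2'[of "g l'" b 0 r] final[OF l'] \<open>r < b\<close> by auto
    moreover from this have "s \<in> S" using l' l(2) by (auto simp: S_def intro!: bexI[of _ l'])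
    ultimately show False using last[of s] \<open>\<not> g l' r \<le> 0\<close> by auto
  qed
  then have "g l r = 0" using l by (intro antisym) auto
  then obtain s where "s > r" "s \<le> b" "0 \<le> g l s"
    using step[OF l(1) l(2) \<open>r < b\<close> _ nonpos] by blast
  then have "s \<in> S" using l by (auto simp: S_def intro!: bexI[of _ l])
  with last[of s] \<open>s > r\<close> show False by auto
qed

text \<open>The derivative on the simplex is a limit from the right along a segment, so the mean value
inequality is needed for right derivatives only.\<close>

lemma right_derivative_le_imp_increment_le:
  fixes f :: "real \<Rightarrow> real"
  assumes h: "0 \<le> h" and cont: "continuous_on {0..h} f"
    and deriv: "\<And>s. \<lbrakk>0 \<le> s; s < h\<rbrakk> \<Longrightarrow>
      ((\<lambda>e. (f (s + e) - f s) / e) \<longlongrightarrow> f' s) (at_right 0)"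
    and le: "\<And>s. \<lbrakk>0 \<le> s; s < h\<rbrakk> \<Longrightarrow> f' s \<le> c"
  shows "f h - f 0 \<le> c * h"
proof (rule field_le_epsilon)
  fix \<epsilon> :: real assume "0 < \<epsilon>"
  \<comment> \<open>The slope is raised by \<open>\<eta>\<close> to make the comparison strict, and the gap \<open>g\<close> is lowered by \<open>\<eta>\<close> to make it negative at \<open>h\<close>.\<close>
  define \<eta> where "\<eta> = \<epsilon> / (h + 1)"
  have "\<eta> * (h + 1) = \<epsilon>" "0 < \<eta>" using \<open>0 < \<epsilon>\<close> h by (simp_all add: \<eta>_def)
  then have \<eta>: "0 < \<eta>" "\<eta> * h + \<eta> = \<epsilon>" by (simp_all add: distrib_left)
  define g where "g = (\<lambda>s. f h - f s - (c + \<eta>) * (h - s) - \<eta>)"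
  have "g 0 < 0"
  proof (rule family_negative_backward[of "{()}" 0 h "\<lambda>_. g" "()" 0])
    fix s assume s: "0 \<le> s" "s < h" "g s = 0"
    have "((\<lambda>e. (c + \<eta>) - (f (s + e) - f s) / e) \<longlongrightarrow> (c + \<eta>) - f' s) (at_right 0)"
      by (intro tendsto_intros deriv s)
    moreover have "0 < (c + \<eta>) - f' s" using le[of s] s \<eta> by auto
    ultimately have "\<forall>\<^sub>F e in at_right 0. 0 < (c + \<eta>) - (f (s + e) - f s) / e"
      by (rule order_tendstoD)
    moreover have "\<forall>\<^sub>F e in at_right 0. 0 < e \<and> e < h - s"
      using s by (auto simp: eventually_at_right_field intro!: exI[of _ "h - s"])
    ultimately have "\<forall>\<^sub>F e in at_right 0. 0 < e \<and> e < h - s \<and> 0 < (c + \<eta>) - (f (s + e) - f s) / e"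
      by eventually_elim auto
    then obtain e where e: "0 < e" "e < h - s" "0 < (c + \<eta>) - (f (s + e) - f s) / e"
      by (auto dest!: eventually_happens)
    have "g (s + e) - g s = e * ((c + \<eta>) - (f (s + e) - f s) / e)"
      using e by (simp add: g_def field_simps)
    also have "\<dots> > 0" using e by simp
    finally show "\<exists>r>s. r \<le> h \<and> 0 \<le> g r" using e s by (intro exI[of _ "s + e"]) auto
  qed (use \<eta> h in \<open>auto simp: g_def intro!: continuous_intros cont\<close>)
  then show "f h - f 0 \<le> c * h + \<epsilon>" using \<eta> by (simp add: g_def algebra_simps)
qed

lemma right_derivative_near_imp_increment_near:
  fixes f :: "real \<Rightarrow> real"
  assumes h: "0 \<le> h" and cont: "continuous_on {0..h} f"
    and deriv: "\<And>s. \<lbrakk>0 \<le> s; s < h\<rbrakk> \<Longrightarrow>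
      ((\<lambda>e. (f (s + e) - f s) / e) \<longlongrightarrow> f' s) (at_right 0)"
    and near: "\<And>s. \<lbrakk>0 \<le> s; s < h\<rbrakk> \<Longrightarrow> \<bar>f' s - c\<bar> \<le> \<delta>"
  shows "\<bar>f h - f 0 - h * c\<bar> \<le> \<delta> * h"
proof -
  have "f h - f 0 \<le> (c + \<delta>) * h"
  proof (rule right_derivative_le_imp_increment_le[OF h cont deriv])
    fix s assume "0 \<le> s" "s < h"
    then show "f' s \<le> c + \<delta>" using near[of s] by linarith
  qed
  moreover have "(- f h) - (- f 0) \<le> (\<delta> - c) * h"
  proof (rule right_derivative_le_imp_increment_le[OF h, where f' = "\<lambda>s. - f' s"])
    fix s assume "0 \<le> s" "s < h"
    from tendsto_minus[OF deriv[OF this]]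
    show "((\<lambda>e. (- f (s + e) - - f s) / e) \<longlongrightarrow> - f' s) (at_right 0)"
      by (simp add: diff_divide_distrib)
    show "- f' s \<le> \<delta> - c" using near[OF \<open>0 \<le> s\<close> \<open>s < h\<close>] by linarith
  qed (intro continuous_intros cont)
  ultimately show ?thesis by (simp add: abs_le_iff algebra_simps)
qed

text \<open>A Gronwall estimate for the maximum of a finite family. The differential inequality is required only
of a member that realises the maximum at the given time, which is where a discrete maximum principle
provides it. The barrier \<open>\<psi>\<close> below satisfies \<open>- \<psi>' = (a + 1) \<psi> > a \<psi> + b\<close> because \<open>\<psi> > b\<close>, so a
member cannot touch it from below.\<close>

lemma backward_comparison:
  fixes f :: "'k \<Rightarrow> real \<Rightarrow> real"
  assumes fin: "finite I" and a: "0 \<le> a" and b: "0 < b"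
    and deriv: "\<And>k t. \<lbrakk>k \<in> I; t \<in> {0..T}\<rbrakk> \<Longrightarrow> (f k has_real_derivative f' k t) (at t within {0..T})"
    and final: "\<And>k. k \<in> I \<Longrightarrow> f k T \<le> 0"
    and growth: "\<And>k t. \<lbrakk>k \<in> I; t \<in> {0..T}; \<And>l. l \<in> I \<Longrightarrow> f l t \<le> f k t\<rbrakk>
      \<Longrightarrow> - f' k t \<le> a * f k t + b"
    and k: "k \<in> I" and t: "t \<in> {0..T}"
  shows "f k t \<le> 2 * b * exp ((a + 1) * T)"
proof -
  define \<psi> where "\<psi> = (\<lambda>t. 2 * b * exp ((a + 1) * (T - t)))"
  have "f k t - \<psi> t < 0"
  proof (rule family_negative_backward[of I 0 T "\<lambda>k t. f k t - \<psi> t"])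
    fix l assume "l \<in> I"
    then show "continuous_on {0..T} (\<lambda>t. f l t - \<psi> t)" unfolding \<psi>_def
      by (intro continuous_intros DERIV_continuous_on[OF deriv])
    show "f l T - \<psi> T < 0" using final[OF \<open>l \<in> I\<close>] b by (simp add: \<psi>_def)
  next
    fix l r assume l: "l \<in> I" and r: "0 \<le> r" "r < T" and eq: "f l r - \<psi> r = 0"
      and le: "\<And>l'. l' \<in> I \<Longrightarrow> f l' r - \<psi> r \<le> 0"
    have "(\<psi> has_real_derivative (- (a + 1) * \<psi> r)) (at r within {0..T})"
      unfolding \<psi>_def by (auto intro!: derivative_eq_intros)
    then have der: "((\<lambda>t. f l t - \<psi> t) has_real_derivative f' l r - (- (a + 1) * \<psi> r)) (at r within {0..T})"
      using r by (intro DERIV_diff deriv l) auto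
    have "- f' l r \<le> a * \<psi> r + b"
      using growth[OF l, of r] le eq r by auto
    moreover have "b < \<psi> r"
    proof -
      have "1 \<le> exp ((a + 1) * (T - r))" using a r by simp
      then have "2 * b * 1 \<le> \<psi> r" unfolding \<psi>_def using b by (intro mult_left_mono) auto
      then show ?thesis using b by linarith
    qed
    ultimately have "0 < f' l r - (- (a + 1) * \<psi> r)" by (simp add: algebra_simps)
    from has_real_derivative_pos_inc_right[OF der this] obtain d where "d > 0"
      and d: "\<And>h. \<lbrakk>0 < h; r + h \<in> {0..T}; h < d\<rbrakk> \<Longrightarrow> f l r - \<psi> r < f l (r + h) - \<psi> (r + h)"
      by blast
    define h where "h = min (d / 2) (T - r)"
    have "0 < h" "r + h \<in> {0..T}" "h < d" using \<open>d > 0\<close> r by (auto simp: h_def min_def)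
    then show "\<exists>s>r. s \<le> T \<and> 0 \<le> f l s - \<psi> s"
      using d[of h] eq by (intro exI[of _ "r + h"]) auto
  qed (use fin k t in auto)
  moreover have "\<psi> t \<le> 2 * b * exp ((a + 1) * T)"
    unfolding \<psi>_def using a b t by (auto intro!: mult_left_mono)
  ultimately show ?thesis by linarith
qed

section \<open>Functions on the simplex\<close>

lemma simplex_nonneg: "m \<in> prob_simplex \<Longrightarrow> 0 \<le> m $ j"
  and simplex_sum: "m \<in> prob_simplex \<Longrightarrow> (\<Sum>j\<in>UNIV. m $ j) = 1"
  by (auto simp: prob_simplex_def)

lemma simplex_le_1:
  assumes "m \<in> prob_simplex" shows "m $ j \<le> 1"
proof -
  have "m $ j \<le> (\<Sum>j\<in>UNIV. m $ j)"
    using simplex_nonneg[OF assms] by (intro member_le_sum) auto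
  then show ?thesis using simplex_sum[OF assms] by simp
qed

lemma simplex_transfer:
  assumes m: "m \<in> prob_simplex" and h: "0 \<le> h" "h \<le> m $ y"
  shows "m + h *\<^sub>R (axis z 1 - axis y 1) \<in> prob_simplex"
proof -
  have "(\<Sum>j\<in>UNIV. (m + h *\<^sub>R (axis z 1 - axis y 1)) $ j)
      = (\<Sum>j\<in>UNIV. m $ j) + h * ((\<Sum>j\<in>UNIV. axis z 1 $ j) - (\<Sum>j\<in>UNIV. axis y 1 $ j))"
    by (simp add: sum.distrib sum_subtractf flip: sum_distrib_left)
  also have "\<dots> = 1" using simplex_sum[OF m] by (simp add: axis_def)
  finally show ?thesis
    using h simplex_nonneg[OF m] by (auto simp: prob_simplex_def axis_def)
qed

lemma axis_in_simplex: "axis y 1 \<in> prob_simplex"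
  by (auto simp: prob_simplex_def axis_def)

lemma norm_le_card_mult:
  fixes v :: "real ^ 'd::finite"
  assumes "\<And>j. \<bar>v $ j\<bar> \<le> r"
  shows "norm v \<le> real CARD('d) * r"
proof -
  have "norm v \<le> (\<Sum>j\<in>UNIV. \<bar>v $ j\<bar>)" by (rule norm_le_l1_cart)
  also have "\<dots> \<le> (\<Sum>j\<in>(UNIV::'d set). r)" by (intro sum_mono assms)
  finally show ?thesis by simp
qed

lemma norm_simplex_le: "m \<in> prob_simplex \<Longrightarrow> norm (m :: real ^ 'd::finite) \<le> real CARD('d)"
  using norm_le_card_mult[of m 1] simplex_nonneg simplex_le_1 by fastforce

lemma compact_simplex: "compact (prob_simplex :: (real ^ 'd::finite) set)"
proof -
  have "bounded (prob_simplex :: (real ^ 'd) set)"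
    using norm_simplex_le by (auto simp: bounded_iff)
  moreover have eq: "prob_simplex = (\<Inter>j. {m :: real ^ 'd. 0 \<le> m $ j}) \<inter> {m. (\<Sum>j\<in>UNIV. m $ j) = 1}"
    by (auto simp: prob_simplex_def)
  have "closed (prob_simplex :: (real ^ 'd) set)"
    unfolding eq by (intro closed_Int closed_INT closed_Collect_le closed_Collect_eq continuous_intros ballI)
  ultimately show ?thesis by (simp add: compact_eq_bounded_closed)
qed

lemma norm_axis_diff_le: "norm (axis z 1 - axis y 1 :: real ^ 'd::finite) \<le> 2"
  using norm_triangle_ineq4[of "axis z 1 :: real ^ 'd" "axis y 1"] by (simp add: norm_axis_1)

text \<open>A Lipschitz derivative gives a quadratic remainder: along the segment that moves mass \<open>h\<close> from \<open>y\<close>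
to \<open>z\<close>, the right derivative of \<open>V\<close> is \<open>D (\<dots>) y $ z\<close>, and it varies by at most \<open>2 * B * h\<close>. The
condition \<open>h \<le> m $ y\<close> keeps the segment in the simplex.\<close>

lemma transfer_expansion:
  fixes V :: "real ^ 'd::finite \<Rightarrow> real"
  assumes der: "has_simplex_deriv V D" and cont: "continuous_on prob_simplex V"
    and lip: "B-lipschitz_on prob_simplex (\<lambda>m. D m y)"
    and m: "m \<in> prob_simplex" and h: "0 \<le> h" "h \<le> m $ y"
  shows "\<bar>V (m + h *\<^sub>R (axis z 1 - axis y 1)) - V m - h * D m y $ z\<bar> \<le> 2 * B * h\<^sup>2"
proof -
  define e :: "real ^ 'd" where "e = axis z 1 - axis y 1"
  have inS: "m + s *\<^sub>R e \<in> prob_simplex" if "0 \<le> s" "s \<le> h" for s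
    unfolding e_def using that h m by (intro simplex_transfer) auto
  have "\<bar>V (m + h *\<^sub>R e) - V (m + 0 *\<^sub>R e) - h * D m y $ z\<bar> \<le> (2 * B * h) * h"
  proof (rule right_derivative_near_imp_increment_near[where f' = "\<lambda>s. D (m + s *\<^sub>R e) y $ z"])
    show "continuous_on {0..h} (\<lambda>s. V (m + s *\<^sub>R e))"
      by (rule continuous_on_compose2[OF cont]) (auto intro!: continuous_intros inS)
  next
    fix s assume s: "0 \<le> s" "s < h"
    have shift: "m + s *\<^sub>R e + r *\<^sub>R e = m + (s + r) *\<^sub>R e" for r
      by (simp add: algebra_simps)
    have "\<forall>\<^sub>F r in at_right 0. m + s *\<^sub>R e + r *\<^sub>R e \<in> prob_simplex"
      unfolding shift eventually_at_right_field using s by (intro exI[of _ "h - s"]) (auto intro: inS)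
    then have "((\<lambda>r. (V (m + s *\<^sub>R e + r *\<^sub>R e) - V (m + s *\<^sub>R e)) / r)
        \<longlongrightarrow> D (m + s *\<^sub>R e) y $ z) (at_right 0)"
      using der inS[of s] s unfolding has_simplex_deriv_def e_def by simp
    then show "((\<lambda>r. (V (m + (s + r) *\<^sub>R e) - V (m + s *\<^sub>R e)) / r)
        \<longlongrightarrow> D (m + s *\<^sub>R e) y $ z) (at_right 0)"
      by (simp only: shift)
    have "\<bar>D (m + s *\<^sub>R e) y $ z - D m y $ z\<bar> \<le> norm (D (m + s *\<^sub>R e) y - D m y)"
      using component_le_norm_cart[of "D (m + s *\<^sub>R e) y - D m y" z] by simp
    also have "\<dots> \<le> B * norm (m + s *\<^sub>R e - m)"
      using lipschitz_onD[OF lip inS[of s] m] s by (simp add: dist_norm)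
    also have "\<dots> = B * (s * norm e)" using s by simp
    also have "\<dots> \<le> B * (h * 2)"
      using s norm_axis_diff_le[of z y] lipschitz_on_nonneg[OF lip]
      by (intro mult_left_mono mult_mono) (auto simp: e_def)
    finally show "\<bar>D (m + s *\<^sub>R e) y $ z - D m y $ z\<bar> \<le> 2 * B * h" by simp
  qed (use h in auto)
  then show ?thesis by (simp add: e_def power2_eq_square)
qed

text \<open>The bound involves only \<open>B\<close> and the size of \<open>V\<close>, so it is uniform in \<open>t\<close> for \<open>V = U t x\<close>;
compactness in time is of no help, as \<open>D\<close> need not be continuous in \<open>t\<close>. Expanding \<open>V\<close> along the
whole edge from \<open>\<delta>\<^sub>y\<close> to \<open>\<delta>\<^sub>z\<close> bounds \<open>D\<close> at the vertex \<open>\<delta>\<^sub>y\<close>, and the Lipschitz property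
carries the bound to every \<open>m\<close>.\<close>

lemma simplex_deriv_bounded:
  fixes V :: "real ^ 'd::finite \<Rightarrow> real"
  assumes der: "has_simplex_deriv V D" and cont: "continuous_on prob_simplex V"
    and lip: "B-lipschitz_on prob_simplex (\<lambda>m. D m y)"
    and bound: "\<And>m. m \<in> prob_simplex \<Longrightarrow> \<bar>V m\<bar> \<le> S"
    and m: "m \<in> prob_simplex"
  shows "\<bar>D m y $ z\<bar> \<le> 2 * S + 2 * B + B * real (2 * CARD('d))"
proof -
  let ?\<delta> = "axis y 1 :: real ^ 'd"
  have "\<bar>V (?\<delta> + 1 *\<^sub>R (axis z 1 - ?\<delta>)) - V ?\<delta> - 1 * D ?\<delta> y $ z\<bar> \<le> 2 * B * 1\<^sup>2"
    by (rule transfer_expansion[OF der cont lip axis_in_simplex]) (auto simp: axis_def)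
  then have "\<bar>V (axis z 1) - V ?\<delta> - D ?\<delta> y $ z\<bar> \<le> 2 * B" by simp
  then have "\<bar>D ?\<delta> y $ z\<bar> \<le> 2 * S + 2 * B"
    using bound[OF axis_in_simplex[of z]] bound[OF axis_in_simplex[of y]] by linarith
  moreover have "\<bar>D m y $ z - D ?\<delta> y $ z\<bar> \<le> B * real (2 * CARD('d))"
  proof -
    have "norm (m - ?\<delta>) \<le> real (2 * CARD('d))"
      using norm_triangle_ineq4[of m ?\<delta>] norm_simplex_le[OF m] norm_simplex_le[OF axis_in_simplex[of y]] by linarith
    moreover have "\<bar>D m y $ z - D ?\<delta> y $ z\<bar> \<le> norm (D m y - D ?\<delta> y)"
      using component_le_norm_cart[of "D m y - D ?\<delta> y" z] by simp
    moreover have "norm (D m y - D ?\<delta> y) \<le> B * norm (m - ?\<delta>)"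
      using lipschitz_onD[OF lip m axis_in_simplex[of y]] by (simp add: dist_norm)
    ultimately show ?thesis
      using lipschitz_on_nonneg[OF lip] mult_left_mono[of "norm (m - ?\<delta>)" "real (2 * CARD('d))" B]
      by linarith
  qed
  ultimately show ?thesis by linarith
qed

definition l1_dist :: "real ^ 'd::finite \<Rightarrow> real ^ 'd \<Rightarrow> real" where
  "l1_dist m m' = (\<Sum>j\<in>UNIV. \<bar>m $ j - m' $ j\<bar>)"

text \<open>A measure is carried to another one by finitely many transfers of mass from a state \<open>y\<close> with too much
to a state \<open>z\<close> with too little. Moving the smaller of the surplus of \<open>y\<close> and the deficit of \<open>z\<close> makes
one of the two states correct, so the number of differing states drops, while the \<open>\<ell>\<^sup>1\<close> distance
drops by twice the mass moved.\<close>

lemma lipschitz_of_transfer_bound: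
  fixes V :: "real ^ 'd::finite \<Rightarrow> real"
  assumes transfer: "\<And>m y z h. \<lbrakk>m \<in> prob_simplex; 0 \<le> h; h \<le> m $ y\<rbrakk>
      \<Longrightarrow> \<bar>V (m + h *\<^sub>R (axis z 1 - axis y 1)) - V m\<bar> \<le> c * h"
    and "m \<in> prob_simplex" "m' \<in> prob_simplex"
  shows "\<bar>V m - V m'\<bar> \<le> c * l1_dist m m'"
  using assms(2)
proof (induction "card {j. m $ j \<noteq> m' $ j}" arbitrary: m rule: less_induct)
  case less
  note m = less.prems and m' = assms(3)
  have c: "0 \<le> c"
  proof -
    fix y :: 'd
    have "0 \<le> \<bar>V (axis y 1 + 1 *\<^sub>R (axis y 1 - axis y 1)) - V (axis y 1)\<bar>" by (rule abs_ge_zero)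
    also have "\<dots> \<le> c * 1" by (intro transfer axis_in_simplex) (auto simp: axis_def)
    finally show "0 \<le> c" by simp
  qed
  show ?case
  proof (cases "m = m'")
    case True
    then show ?thesis by (simp add: l1_dist_def)
  next
    case False
    have sums: "(\<Sum>j\<in>UNIV. m $ j) = (\<Sum>j\<in>UNIV. m' $ j)"
      using simplex_sum[OF m] simplex_sum[OF m'] by simp
    have "\<exists>y. m' $ y < m $ y"
    proof (rule ccontr)
      assume "\<not> (\<exists>y. m' $ y < m $ y)"
      then have *: "\<And>j. m $ j \<le> m' $ j" by (simp add: not_less)
      moreover obtain k where "m $ k \<noteq> m' $ k" using False by (auto simp: vec_eq_iff)
      ultimately have "m $ k < m' $ k" using order_less_le by blast
      then have "(\<Sum>j\<in>UNIV. m $ j) < (\<Sum>j\<in>UNIV. m' $ j)"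
        using * by (intro sum_strict_mono_ex1) auto
      with sums show False by simp
    qed
    then obtain y where y: "m' $ y < m $ y" ..
    have "\<exists>z. m $ z < m' $ z"
    proof (rule ccontr)
      assume "\<not> (\<exists>y. m $ y < m' $ y)"
      then have "\<And>j. m' $ j \<le> m $ j" by (simp add: not_less)
      then have "(\<Sum>j\<in>UNIV. m' $ j) < (\<Sum>j\<in>UNIV. m $ j)"
        using y by (intro sum_strict_mono_ex1) auto
      with sums show False by simp
    qed
    then obtain z where z: "m $ z < m' $ z" ..
    have yz: "y \<noteq> z" using y z by auto
    define h where "h = min (m $ y - m' $ y) (m' $ z - m $ z)"
    have h: "0 < h" "h \<le> m $ y" using y z simplex_nonneg[OF m', of y] by (auto simp: h_def min_def)
    define p where "p = m + h *\<^sub>R (axis z 1 - axis y 1)"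
    have p: "p \<in> prob_simplex" unfolding p_def using h by (intro simplex_transfer m) auto
    have p_nth: "p $ j = (if j = z then m $ z + h else if j = y then m $ y - h else m $ j)" for j
      using yz by (auto simp: p_def axis_def)
    have "{j. p $ j \<noteq> m' $ j} \<subset> {j. m $ j \<noteq> m' $ j}"
    proof -
      have "{j. p $ j \<noteq> m' $ j} \<subseteq> {j. m $ j \<noteq> m' $ j}"
        using y z by (auto simp: p_nth split: if_splits)
      moreover have "p $ y = m' $ y \<or> p $ z = m' $ z" using yz by (auto simp: p_nth h_def min_def)
      ultimately show ?thesis using y z by auto
    qed
    then have "card {j. p $ j \<noteq> m' $ j} < card {j. m $ j \<noteq> m' $ j}"
      by (intro psubset_card_mono) auto
    from less.hyps[OF this p] have "\<bar>V p - V m'\<bar> \<le> c * l1_dist p m'" .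
    moreover have "\<bar>V p - V m\<bar> \<le> c * h"
      unfolding p_def using h by (intro transfer m) auto
    \<comment> \<open>Counting the gain at \<open>y\<close> alone suffices.\<close>
    moreover have "l1_dist p m' + h \<le> l1_dist m m'"
    proof -
      have "\<bar>p $ j - m' $ j\<bar> + (if j = y then h else 0) \<le> \<bar>m $ j - m' $ j\<bar>" for j
        using y z yz by (auto simp: p_nth h_def min_def)
      then have "(\<Sum>j\<in>UNIV. \<bar>p $ j - m' $ j\<bar> + (if j = y then h else 0)) \<le> l1_dist m m'"
        unfolding l1_dist_def by (intro sum_mono) auto
      then show ?thesis by (simp add: sum.distrib l1_dist_def)
    qed
    then have "c * l1_dist p m' + c * h \<le> c * l1_dist m m'"
      using c by (metis distrib_left mult_left_mono)
    ultimately show ?thesis by linarith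
  qed
qed

text \<open>What the convergence proof uses of a regular solution, with one constant for all times and states:
the first-order expansion under small transfers of mass and the Lipschitz continuity in the measure.\<close>

lemma regular_solution_estimates:
  assumes "regular_master_solution A L T F G (U :: real \<Rightarrow> 'd::finite \<Rightarrow> real ^ 'd \<Rightarrow> real)"
  obtains c D where "0 \<le> c" "classical_master_solution A L T F G U D"
    "\<And>t x m y z h. \<lbrakk>t \<in> {0..T}; m \<in> prob_simplex; 0 \<le> h; h \<le> m $ y\<rbrakk>
      \<Longrightarrow> \<bar>U t x (m + h *\<^sub>R (axis z 1 - axis y 1)) - U t x m - h * D t x m y $ z\<bar> \<le> c * h\<^sup>2"
    "\<And>t x m m'. \<lbrakk>t \<in> {0..T}; m \<in> prob_simplex; m' \<in> prob_simplex\<rbrakk>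
      \<Longrightarrow> \<bar>U t x m - U t x m'\<bar> \<le> c * l1_dist m m'"
proof -
  from assms obtain D B where cl: "classical_master_solution A L T F G U D"
    and lip: "\<And>t x y. t \<in> {0..T} \<Longrightarrow> B-lipschitz_on prob_simplex (\<lambda>m. D t x m y)"
    unfolding regular_master_solution_def by blast
  have der: "\<And>t x. t \<in> {0..T} \<Longrightarrow> has_simplex_deriv (U t x) (D t x)"
    and jc: "\<And>x. continuous_on ({0..T} \<times> prob_simplex) (\<lambda>(t, m). U t x m)"
    using cl unfolding classical_master_solution_def by auto
  have cont: "continuous_on prob_simplex (U t x)" if "t \<in> {0..T}" for t x
  proof -
    have "continuous_on prob_simplex (\<lambda>m. case (t, m) of (t, m) \<Rightarrow> U t x m)"
      by (rule continuous_on_compose2[OF jc]) (use that in \<open>auto intro!: continuous_on_Pair continuous_on_const continuous_on_id\<close>)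
    then show ?thesis by simp
  qed
  have "\<exists>S. \<forall>t\<in>{0..T}. \<forall>m\<in>prob_simplex. \<bar>U t x m\<bar> \<le> S" for x
  proof -
    have "compact ((\<lambda>(t, m). U t x m) ` ({0..T} \<times> prob_simplex))"
      by (intro compact_continuous_image jc compact_Times compact_simplex) auto
    then have "bounded ((\<lambda>(t, m). U t x m) ` ({0..T} \<times> prob_simplex))"
      by (rule compact_imp_bounded)
    then show ?thesis unfolding bounded_iff by fastforce
  qed
  then obtain S where S: "\<And>x t m. \<lbrakk>t \<in> {0..T}; m \<in> prob_simplex\<rbrakk> \<Longrightarrow> \<bar>U t x m\<bar> \<le> S x"
    by metis
  define S' where "S' = (\<Sum>x\<in>UNIV. \<bar>S x\<bar>)"
  have S': "\<bar>U t x m\<bar> \<le> S'" if "t \<in> {0..T}" "m \<in> prob_simplex" for t x m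
  proof -
    have "\<bar>S x\<bar> \<le> S'" unfolding S'_def by (rule member_le_sum) auto
    with S[OF that, of x] show ?thesis by linarith
  qed
  define B' where "B' = \<bar>B\<bar>"
  have lip: "B'-lipschitz_on prob_simplex (\<lambda>m. D t x m y)" if "t \<in> {0..T}" for t x y
    unfolding B'_def using lip[OF that] by (rule lipschitz_on_mono) auto
  define d1 where "d1 = 2 * S' + 2 * B' + B' * real (2 * CARD('d))"
  define c where "c = d1 + 2 * B'"
  have "0 \<le> S'" "0 \<le> B'" unfolding S'_def B'_def by (auto intro: sum_nonneg)
  then have d1: "0 \<le> d1" unfolding d1_def by simp
  have exp: "\<bar>U t x (m + h *\<^sub>R (axis z 1 - axis y 1)) - U t x m - h * D t x m y $ z\<bar> \<le> 2 * B' * h\<^sup>2"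
    if "t \<in> {0..T}" "m \<in> prob_simplex" "0 \<le> h" "h \<le> m $ y" for t x m y z h
    by (rule transfer_expansion[OF der cont lip]) (use that in auto)
  have Dle: "\<bar>D t x m y $ z\<bar> \<le> d1" if "t \<in> {0..T}" "m \<in> prob_simplex" for t x m y z
    unfolding d1_def by (rule simplex_deriv_bounded[OF der cont lip S']) (use that in auto)
  show thesis
  proof (rule that[of c D])
    show "0 \<le> c" using d1 \<open>0 \<le> B'\<close> by (simp add: c_def)
    show "classical_master_solution A L T F G U D" by (rule cl)
  next
    fix t x y z h and m :: "real ^ 'd"
    assume *: "t \<in> {0..T}" "m \<in> prob_simplex" "0 \<le> h" "h \<le> m $ y"
    have "2 * B' * h\<^sup>2 \<le> c * h\<^sup>2" using d1 by (intro mult_right_mono) (auto simp: c_def)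
    with exp[OF *, of x z]
    show "\<bar>U t x (m + h *\<^sub>R (axis z 1 - axis y 1)) - U t x m - h * D t x m y $ z\<bar> \<le> c * h\<^sup>2"
      by linarith
  next
    fix t x and m m' :: "real ^ 'd"
    assume t: "t \<in> {0..T}" and mm: "m \<in> prob_simplex" "m' \<in> prob_simplex"
    have "\<bar>U t x (m + h *\<^sub>R (axis z 1 - axis y 1)) - U t x m\<bar> \<le> c * h"
      if *: "m \<in> prob_simplex" "0 \<le> h" "h \<le> m $ y" for m y z h
    proof -
      have "h \<le> 1" using * simplex_le_1[of m y] by auto
      then have "h\<^sup>2 \<le> h" using * by (simp add: power2_eq_square mult_left_le)
      then have "2 * B' * h\<^sup>2 \<le> 2 * B' * h" using \<open>0 \<le> B'\<close> by (intro mult_left_mono) auto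
      moreover have "\<bar>h * D t x m y $ z\<bar> \<le> h * d1"
        using * Dle[OF t *(1), of x y z] by (simp add: abs_mult mult_left_mono)
      ultimately show ?thesis using exp[OF t *, of x z] by (simp add: c_def algebra_simps)
    qed
    then show "\<bar>U t x m - U t x m'\<bar> \<le> c * l1_dist m m'"
      by (rule lipschitz_of_transfer_bound) (use mm in auto)
  qed
qed

section \<open>Empirical measures and finite differences\<close>

lemma fun_upd_in_configs: "x \<in> configs N \<Longrightarrow> j \<in> {1..N} \<Longrightarrow> x(j := y) \<in> configs N"
  by (auto simp: configs_def PiE_iff extensional_def)

lemma finite_configs: "finite (configs N :: (nat \<Rightarrow> 'd::finite) set)"
  unfolding configs_def by (intro finite_PiE) auto

lemma fin_diff_at_diff:
  "fin_diff_at j (\<lambda>y. f y - g y) x = fin_diff_at j f x - fin_diff_at j g x"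
  by (simp add: fin_diff_at_def vec_eq_iff)

lemma norm_fin_diff_at_le:
  fixes g :: "(nat \<Rightarrow> 'd::finite) \<Rightarrow> real"
  assumes "\<And>y. y \<in> configs N \<Longrightarrow> \<bar>g y\<bar> \<le> \<phi>" "x \<in> configs N" "j \<in> {1..N}"
  shows "norm (fin_diff_at j g x) \<le> real CARD('d) * (2 * \<phi>)"
proof (rule norm_le_card_mult)
  fix y
  show "\<bar>fin_diff_at j g x $ y\<bar> \<le> 2 * \<phi>"
    using assms(1)[OF assms(2)] assms(1)[OF fun_upd_in_configs[OF assms(2,3), of y]]
    by (simp add: fin_diff_at_def)
qed

lemma l1_dist_scaled_le:
  assumes "0 \<le> r" "q \<in> prob_simplex" "q' \<in> prob_simplex" "p - p' = r *\<^sub>R (q - q')"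
  shows "l1_dist p p' \<le> 2 * r"
proof -
  have "l1_dist p p' = (\<Sum>j\<in>UNIV. r * \<bar>q $ j - q' $ j\<bar>)"
  proof -
    have "p $ j - p' $ j = r * (q $ j - q' $ j)" for j
      using arg_cong[OF assms(4), of "\<lambda>v. v $ j"] by simp
    then show ?thesis using assms(1) by (simp add: l1_dist_def abs_mult)
  qed
  also have "\<dots> \<le> (\<Sum>j\<in>UNIV. r * (q $ j + q' $ j))"
    using assms(1) simplex_nonneg[OF assms(2)] simplex_nonneg[OF assms(3)]
    by (intro sum_mono mult_left_mono) (auto simp: abs_le_iff add_increasing add_increasing2)
  also have "\<dots> = 2 * r"
    using simplex_sum[OF assms(2)] simplex_sum[OF assms(3)]
    by (simp add: sum.distrib flip: sum_distrib_left)
  finally show ?thesis .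
qed

context
  fixes N i :: nat
  assumes N: "2 \<le> N" and i: "i \<in> {1..N}"
begin

lemma card_others: "real (card ({1..N} - {i})) = real N - 1"
  using N i by (simp add: of_nat_diff)

lemma emp_measure_except_nth:
  "emp_measure_except N i x $ y
    = (1 / (real N - 1)) * (\<Sum>j\<in>{1..N} - {i}. if x j = y then 1 else 0)"
  unfolding emp_measure_except_def
  by (simp add: axis_def) (intro disjI2 sum.cong; auto)

lemma integral_emp_measure_except:
  fixes x :: "nat \<Rightarrow> 'd::finite"
  shows "(\<Sum>y\<in>UNIV. f y * emp_measure_except N i x $ y)
    = (1 / (real N - 1)) * (\<Sum>j\<in>{1..N} - {i}. f (x j))"
proof -
  have "(\<Sum>y\<in>UNIV. f y * emp_measure_except N i x $ y)
      = (\<Sum>y\<in>UNIV. \<Sum>j\<in>{1..N} - {i}. (1 / (real N - 1)) * (if y = x j then f y else 0))"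
    unfolding emp_measure_except_nth sum_distrib_left
    by (intro sum.cong refl) auto
  also have "\<dots> = (\<Sum>j\<in>{1..N} - {i}. \<Sum>y\<in>UNIV. (1 / (real N - 1)) * (if y = x j then f y else 0))"
    by (rule sum.swap)
  also have "\<dots> = (1 / (real N - 1)) * (\<Sum>j\<in>{1..N} - {i}. f (x j))"
    unfolding sum_distrib_left[symmetric] by simp
  finally show ?thesis .
qed

lemma emp_measure_except_in_simplex: "emp_measure_except N i x \<in> prob_simplex"
proof -
  have "(\<Sum>y\<in>UNIV. emp_measure_except N i x $ y) = 1"
    using integral_emp_measure_except[of "\<lambda>_. 1" x] card_others N by simp
  moreover have "0 \<le> emp_measure_except N i x $ y" for y
    unfolding emp_measure_except_nth using N by (intro mult_nonneg_nonneg sum_nonneg) auto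
  ultimately show ?thesis by (simp add: prob_simplex_def)
qed

lemma emp_measure_except_update_self:
  "emp_measure_except N i (x(i := z)) = emp_measure_except N i x"
  unfolding emp_measure_except_def by (intro arg_cong2[where f = scaleR] sum.cong) auto

lemma emp_measure_except_update_other:
  assumes j: "j \<in> {1..N} - {i}"
  shows "emp_measure_except N i (x(j := z))
    = emp_measure_except N i x + (1 / (real N - 1)) *\<^sub>R (axis z 1 - axis (x j) 1)"
proof -
  have "(\<Sum>k\<in>{1..N} - {i}. axis ((x(j := z)) k) (1::real))
      = axis z 1 + (\<Sum>k\<in>{1..N} - {i} - {j}. axis ((x(j := z)) k) 1)"
    using j by (subst sum.remove[of _ j]) auto
  also have "(\<Sum>k\<in>{1..N} - {i} - {j}. axis ((x(j := z)) k) (1::real))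
      = (\<Sum>k\<in>{1..N} - {i} - {j}. axis (x k) 1)"
    by (intro sum.cong) auto
  also have "\<dots> = (\<Sum>k\<in>{1..N} - {i}. axis (x k) 1) - axis (x j) 1"
    using j by (subst sum.remove[of _ j]) auto
  finally show ?thesis by (simp add: emp_measure_except_def scaleR_diff_right scaleR_add_right)
qed

lemma emp_measure_except_ge:
  assumes j: "j \<in> {1..N} - {i}"
  shows "1 / (real N - 1) \<le> emp_measure_except N i x $ x j"
proof -
  have "(if x j = x j then 1 else (0::real)) \<le> (\<Sum>k\<in>{1..N} - {i}. if x k = x j then 1 else 0)"
    by (rule member_le_sum[OF j]) auto
  then show ?thesis unfolding emp_measure_except_nth using N by (simp add: divide_right_mono)
qed

lemma emp_measure_except_eq:
  "emp_measure_except N i x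
    = (1 / (real N - 1)) *\<^sub>R ((\<Sum>j\<in>{1..N}. axis (x j) 1) - axis (x i) 1)"
  unfolding emp_measure_except_def using i by (simp add: sum_diff1)

text \<open>Adding the player \<open>i\<close> to the other \<open>N - 1\<close> replaces a fraction \<open>1 / N\<close> of their empirical measure
by \<open>\<delta>\<close> at the state of \<open>i\<close>.\<close>

lemma l1_dist_emp_measure:
  "l1_dist (emp_measure N x) (emp_measure_except N i x) \<le> 2 / real N"
proof -
  define S :: "real ^ 'a" where "S = (\<Sum>j\<in>{1..N}. axis (x j) 1)"
  have split: "s / (n + 1) - (s - a) / n = (a - (s - a) / n) / (n + 1)" if "0 < n" for s a n :: real
    using that by (simp add: field_simps)
  have "emp_measure N x - emp_measure_except N i x
      = (1 / real N) *\<^sub>R (axis (x i) 1 - emp_measure_except N i x)"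
    unfolding emp_measure_except_eq emp_measure_def S_def[symmetric] vec_eq_iff
    using split[of "real N - 1"] N by auto
  from l1_dist_scaled_le[OF _ axis_in_simplex emp_measure_except_in_simplex this]
  show ?thesis by simp
qed

end

lemma emp_measure_in_simplex:
  fixes x :: "nat \<Rightarrow> 'd::finite"
  assumes "0 < N"
  shows "emp_measure N x \<in> prob_simplex"
proof -
  have "(\<Sum>y\<in>UNIV. emp_measure N x $ y) = (\<Sum>j\<in>{1..N}. \<Sum>y\<in>UNIV. axis (x j) 1 $ y) / real N"
    by (simp add: emp_measure_def sum.swap[of _ UNIV] flip: sum_divide_distrib)
  also have "\<dots> = 1" using assms by (simp add: axis_def)
  finally have "(\<Sum>y\<in>UNIV. emp_measure N x $ y) = 1" .
  moreover have "0 \<le> emp_measure N x $ y" for y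
    by (auto simp: emp_measure_def axis_def intro!: divide_nonneg_nonneg sum_nonneg)
  ultimately show ?thesis by (simp add: prob_simplex_def)
qed

text \<open>The two measures differ by exchanging one atom of mass \<open>1 / (N - 1)\<close> between the states of \<open>i\<close> and
\<open>j\<close>.\<close>

lemma l1_dist_emp_measure_except:
  assumes N: "2 \<le> N" and i: "i \<in> {1..N}" and j: "j \<in> {1..N}"
  shows "l1_dist (emp_measure_except N j x) (emp_measure_except N i x) \<le> 2 * (1 / (real N - 1))"
  by (rule l1_dist_scaled_le[OF _ axis_in_simplex[of "x i"] axis_in_simplex[of "x j"]])
     (use N in \<open>simp_all add: emp_measure_except_eq[OF N i] emp_measure_except_eq[OF N j]
        algebra_simps\<close>)

text \<open>The value that the mean field solution predicts for player \<open>i\<close>; it is the approximate solution of the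
\<open>N\<close>-player system with which \<open>v\<close> is compared.\<close>

definition mf_value ::
  "(real \<Rightarrow> 'd::finite \<Rightarrow> real ^ 'd \<Rightarrow> real) \<Rightarrow> nat \<Rightarrow> nat \<Rightarrow> real \<Rightarrow> (nat \<Rightarrow> 'd) \<Rightarrow> real" where
  "mf_value U N i t x = U t (x i) (emp_measure_except N i x)"

text \<open>When player \<open>i\<close> changes state, the measure of the others is unaffected: the increment is the finite
difference that enters the Master Equation.\<close>

lemma fin_diff_at_mf_value_self:
  assumes "2 \<le> N" "i \<in> {1..N}"
  shows "fin_diff_at i (mf_value U N i t) x = fin_diff (\<lambda>y. U t y (emp_measure_except N i x)) (x i)"
  by (simp add: fin_diff_at_def fin_diff_def mf_value_def emp_measure_except_update_self[OF assms])

text \<open>When another player changes state, a mass \<open>1 / (N - 1)\<close> is transferred, so the increment is governed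
by \<open>D\<^sup>mU\<close>.\<close>

lemma fin_diff_at_mf_value_other:
  assumes "2 \<le> N" "i \<in> {1..N}" "j \<in> {1..N} - {i}"
  shows "fin_diff_at j (mf_value U N i t) x $ z
    = U t (x i) (emp_measure_except N i x + (1 / (real N - 1)) *\<^sub>R (axis z 1 - axis (x j) 1))
      - U t (x i) (emp_measure_except N i x)"
  using assms(3)
  by (simp add: fin_diff_at_def mf_value_def emp_measure_except_update_other[OF assms])

section \<open>The law of large numbers for product weights\<close>

lemma product_weights_sum:
  fixes m :: "real ^ 'd::finite"
  assumes "finite J" "m \<in> prob_simplex"
  shows "(\<Sum>\<xi>\<in>J \<rightarrow>\<^sub>E UNIV. \<Prod>j\<in>J. m $ \<xi> j) = 1"
  using prod_sum_PiE[of J "\<lambda>_. UNIV" "\<lambda>_ y. m $ y"] assms simplex_sum[OF assms(2)] by simp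

text \<open>Independence: since the weights form a product, the mixed moment is a product of one-player sums, one
of which is the mean \<open>0\<close> when the two players are distinct.\<close>

lemma product_weights_two_point:
  fixes m :: "real ^ 'd::finite"
  assumes J: "finite J" and m: "m \<in> prob_simplex"
    and mean: "(\<Sum>y\<in>UNIV. m $ y * f y) = 0"
    and jk: "j \<in> J" "k \<in> J"
  shows "(\<Sum>\<xi>\<in>J \<rightarrow>\<^sub>E UNIV. (\<Prod>l\<in>J. m $ \<xi> l) * (f (\<xi> j) * f (\<xi> k)))
    = (if j = k then (\<Sum>y\<in>UNIV. m $ y * (f y)\<^sup>2) else 0)"
proof -
  define q where "q = (\<lambda>l y. m $ y * ((if l = j then f y else 1) * (if l = k then f y else 1)))"
  have "(\<Sum>\<xi>\<in>J \<rightarrow>\<^sub>E UNIV. (\<Prod>l\<in>J. m $ \<xi> l) * (f (\<xi> j) * f (\<xi> k)))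
      = (\<Sum>\<xi>\<in>J \<rightarrow>\<^sub>E UNIV. \<Prod>l\<in>J. q l (\<xi> l))"
    using J jk by (intro sum.cong refl) (simp add: q_def prod.distrib)
  also have "\<dots> = (\<Prod>l\<in>J. \<Sum>y\<in>UNIV. q l y)"
    using J by (subst prod_sum_PiE) auto
  also have "\<dots> = (if j = k then (\<Sum>y\<in>UNIV. m $ y * (f y)\<^sup>2) else 0)"
  proof (cases "j = k")
    case True
    have "(\<Prod>l\<in>J. \<Sum>y\<in>UNIV. q l y) = (\<Sum>y\<in>UNIV. q j y) * (\<Prod>l\<in>J - {j}. \<Sum>y\<in>UNIV. q l y)"
      using J jk by (intro prod.remove) auto
    also have "(\<Prod>l\<in>J - {j}. \<Sum>y\<in>UNIV. q l y) = 1"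
      using True simplex_sum[OF m] by (intro prod.neutral) (auto simp: q_def)
    finally show ?thesis using True by (simp add: q_def power2_eq_square)
  next
    case False
    then have "(\<Sum>y\<in>UNIV. q j y) = 0" using mean by (simp add: q_def)
    then show ?thesis using False J jk by (auto intro!: prod_zero)
  qed
  finally show ?thesis .
qed

text \<open>The mean of a sum of independent centred variables is bounded through its second moment, which is at
most the number of terms.\<close>

lemma product_weights_abs_sum_le:
  fixes m :: "real ^ 'd::finite"
  assumes J: "finite J" "J \<noteq> {}" and m: "m \<in> prob_simplex"
    and mean: "(\<Sum>y\<in>UNIV. m $ y * f y) = 0" and bound: "\<And>y. \<bar>f y\<bar> \<le> 1"
  shows "(\<Sum>\<xi>\<in>J \<rightarrow>\<^sub>E UNIV. (\<Prod>j\<in>J. m $ \<xi> j) * \<bar>\<Sum>j\<in>J. f (\<xi> j)\<bar>) \<le> sqrt (real (card J))"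
proof -
  define P where "P = (\<lambda>\<xi>. \<Prod>j\<in>J. m $ \<xi> j)"
  define n where "n = real (card J)"
  have n: "0 < n" using J by (simp add: n_def card_gt_0_iff)
  have P: "0 \<le> P \<xi>" for \<xi> unfolding P_def using simplex_nonneg[OF m] by (intro prod_nonneg) auto
  have var: "(\<Sum>y\<in>UNIV. m $ y * (f y)\<^sup>2) \<le> 1"
  proof -
    have "(\<Sum>y\<in>UNIV. m $ y * (f y)\<^sup>2) \<le> (\<Sum>y\<in>UNIV. m $ y * 1)"
      using simplex_nonneg[OF m] bound
      by (intro sum_mono mult_left_mono) (auto simp: abs_square_le_1)
    then show ?thesis using simplex_sum[OF m] by simp
  qed
  have "(\<Sum>\<xi>\<in>J \<rightarrow>\<^sub>E UNIV. P \<xi> * (\<Sum>j\<in>J. f (\<xi> j))\<^sup>2)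
      = (\<Sum>\<xi>\<in>J \<rightarrow>\<^sub>E UNIV. \<Sum>j\<in>J. \<Sum>k\<in>J. P \<xi> * (f (\<xi> j) * f (\<xi> k)))"
    unfolding power2_eq_square sum_product unfolding sum_distrib_left by (rule refl)
  also have "\<dots> = (\<Sum>j\<in>J. \<Sum>k\<in>J. \<Sum>\<xi>\<in>J \<rightarrow>\<^sub>E UNIV. P \<xi> * (f (\<xi> j) * f (\<xi> k)))"
    by (subst sum.swap, intro sum.cong refl sum.swap)
  also have "\<dots> = (\<Sum>j\<in>J. \<Sum>k\<in>J. if j = k then (\<Sum>y\<in>UNIV. m $ y * (f y)\<^sup>2) else 0)"
    unfolding P_def by (intro sum.cong refl product_weights_two_point J m mean)
  also have "\<dots> = n * (\<Sum>y\<in>UNIV. m $ y * (f y)\<^sup>2)" using J by (simp add: n_def)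
  also have "\<dots> \<le> n" using mult_left_mono[OF var, of n] n by simp
  finally have second_moment: "(\<Sum>\<xi>\<in>J \<rightarrow>\<^sub>E UNIV. P \<xi> * (\<Sum>j\<in>J. f (\<xi> j))\<^sup>2) \<le> n" .
  \<comment> \<open>The weight \<open>sqrt n\<close> balances the two terms when the second moment is about \<open>n\<close>.\<close>
  have young: "\<bar>s\<bar> \<le> (1 / (2 * sqrt n)) * s\<^sup>2 + sqrt n / 2" for s
  proof -
    have "0 \<le> (\<bar>s\<bar> - sqrt n)\<^sup>2" by simp
    then have "2 * sqrt n * \<bar>s\<bar> \<le> s\<^sup>2 + sqrt n * sqrt n"
      using n by (simp add: power2_diff algebra_simps)
    then show ?thesis using n by (simp add: field_simps power2_eq_square)
  qed
  have "(\<Sum>\<xi>\<in>J \<rightarrow>\<^sub>E UNIV. P \<xi> * \<bar>\<Sum>j\<in>J. f (\<xi> j)\<bar>)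
      \<le> (\<Sum>\<xi>\<in>J \<rightarrow>\<^sub>E UNIV. P \<xi> * ((1 / (2 * sqrt n)) * (\<Sum>j\<in>J. f (\<xi> j))\<^sup>2 + sqrt n / 2))"
    by (intro sum_mono mult_left_mono young P)
  also have "\<dots> = (1 / (2 * sqrt n)) * (\<Sum>\<xi>\<in>J \<rightarrow>\<^sub>E UNIV. P \<xi> * (\<Sum>j\<in>J. f (\<xi> j))\<^sup>2)
      + (\<Sum>\<xi>\<in>J \<rightarrow>\<^sub>E UNIV. P \<xi>) * (sqrt n / 2)"
    by (simp add: distrib_left sum.distrib sum_distrib_left sum_distrib_right mult_ac)
  also have "(\<Sum>\<xi>\<in>J \<rightarrow>\<^sub>E UNIV. P \<xi>) = 1"
    unfolding P_def by (rule product_weights_sum) (use J m in auto)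
  also have "(1 / (2 * sqrt n)) * (\<Sum>\<xi>\<in>J \<rightarrow>\<^sub>E UNIV. P \<xi> * (\<Sum>j\<in>J. f (\<xi> j))\<^sup>2) \<le> (1 / (2 * sqrt n)) * n"
    using n by (intro mult_left_mono second_moment) auto
  also have "(1 / (2 * sqrt n)) * n + 1 * (sqrt n / 2) = sqrt n"
    using n by (simp add: field_simps)
  finally show ?thesis by (simp add: P_def n_def)
qed

lemma expected_empirical_distance:
  fixes m :: "real ^ 'd::finite"
  assumes N: "2 \<le> N" and i: "i \<in> {1..N}" and m: "m \<in> prob_simplex"
  shows "(\<Sum>\<xi>\<in>({1..N} - {i}) \<rightarrow>\<^sub>E UNIV. (\<Prod>j\<in>{1..N} - {i}. m $ \<xi> j)
      * l1_dist (emp_measure_except N i \<xi>) m) \<le> real CARD('d) / sqrt (real N - 1)"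
proof -
  define J where "J = {1..N} - {i}"
  define n where "n = real N - 1"
  define P where "P = (\<lambda>\<xi>. \<Prod>j\<in>J. m $ \<xi> j)"
  have n: "0 < n" "real (card J) = n" using N card_others[OF N i] by (auto simp: n_def J_def)
  then have "0 < card J" by linarith
  then have J: "finite J" "J \<noteq> {}" by (simp_all add: card_gt_0_iff)
  define f where "f = (\<lambda>y z. (if z = y then 1 else 0) - m $ y)"
  have fluct: "emp_measure_except N i \<xi> $ y - m $ y = (1 / n) * (\<Sum>j\<in>J. f y (\<xi> j))" for \<xi> y
    using n unfolding emp_measure_except_nth[OF N i] J_def[symmetric] n_def[symmetric] f_def
    by (simp add: sum_subtractf field_simps)
  have l1: "l1_dist (emp_measure_except N i \<xi>) m = (\<Sum>y\<in>UNIV. (1 / n) * \<bar>\<Sum>j\<in>J. f y (\<xi> j)\<bar>)" for \<xi>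
    unfolding l1_dist_def fluct using n by (simp add: abs_mult)
  have "(\<Sum>\<xi>\<in>J \<rightarrow>\<^sub>E UNIV. P \<xi> * l1_dist (emp_measure_except N i \<xi>) m)
      = (\<Sum>\<xi>\<in>J \<rightarrow>\<^sub>E UNIV. \<Sum>y\<in>UNIV. (1 / n) * (P \<xi> * \<bar>\<Sum>j\<in>J. f y (\<xi> j)\<bar>))"
    unfolding l1 sum_distrib_left by (simp add: mult_ac)
  also have "\<dots> = (\<Sum>y\<in>UNIV. (1 / n) * (\<Sum>\<xi>\<in>J \<rightarrow>\<^sub>E UNIV. P \<xi> * \<bar>\<Sum>j\<in>J. f y (\<xi> j)\<bar>))"
    unfolding sum_distrib_left by (rule sum.swap)
  also have "\<dots> \<le> (\<Sum>y\<in>(UNIV::'d set). (1 / n) * sqrt n)"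
  proof (intro sum_mono mult_left_mono)
    fix y
    have "m $ z * f y z = (if z = y then m $ z else 0) - m $ z * m $ y" for z
      by (simp add: f_def right_diff_distrib)
    then have "(\<Sum>z\<in>UNIV. m $ z * f y z) = 0"
      using simplex_sum[OF m] by (simp add: sum_subtractf flip: sum_distrib_right)
    moreover have "\<bar>f y z\<bar> \<le> 1" for z
      using simplex_nonneg[OF m, of y] simplex_le_1[OF m, of y] by (simp add: f_def)
    ultimately show "(\<Sum>\<xi>\<in>J \<rightarrow>\<^sub>E UNIV. P \<xi> * \<bar>\<Sum>j\<in>J. f y (\<xi> j)\<bar>) \<le> sqrt n"
      unfolding P_def n(2)[symmetric] by (intro product_weights_abs_sum_le J m) auto
  qed (use n in auto)
  also have "\<dots> = real CARD('d) / sqrt n"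
    using n by (simp add: field_simps)
  finally show ?thesis by (simp add: P_def J_def n_def)
qed

section \<open>Convergence of the value functions\<close>

text \<open>The quantitative facts about \<open>U\<close>, the Hamiltonian and the feedback control that determine the final
constant. They are collected so that all later bounds visibly depend on \<open>c\<close>, \<open>LH\<close>, \<open>La\<close>, \<open>R\<close>, \<open>T\<close> and the
number of states, and on nothing else.\<close>

locale master_setting =
  fixes T K c LH La R :: real
    and A :: "(real ^ 'd::finite) set"
    and L F G :: "'d \<Rightarrow> real ^ 'd \<Rightarrow> real"
    and U :: "real \<Rightarrow> 'd \<Rightarrow> real ^ 'd \<Rightarrow> real"
    and D :: "real \<Rightarrow> 'd \<Rightarrow> real ^ 'd \<Rightarrow> 'd \<Rightarrow> real ^ 'd"
  assumes c_nonneg: "0 \<le> c" and R_nonneg: "0 \<le> R"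
    and classical: "classical_master_solution A L T F G U D"
    and expansion: "\<And>t x m y z h. \<lbrakk>t \<in> {0..T}; m \<in> prob_simplex; 0 \<le> h; h \<le> m $ y\<rbrakk>
      \<Longrightarrow> \<bar>U t x (m + h *\<^sub>R (axis z 1 - axis y 1)) - U t x m - h * D t x m y $ z\<bar> \<le> c * h\<^sup>2"
    and U_lipschitz: "\<And>t x m m'. \<lbrakk>t \<in> {0..T}; m \<in> prob_simplex; m' \<in> prob_simplex\<rbrakk>
      \<Longrightarrow> \<bar>U t x m - U t x m'\<bar> \<le> c * l1_dist m m'"
    and U_diff_le: "\<And>t x m. \<lbrakk>t \<in> {0..T}; m \<in> prob_simplex\<rbrakk>
      \<Longrightarrow> norm (fin_diff (\<lambda>y. U t y m) x) \<le> K"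
    and H_lipschitz: "\<And>x. LH-lipschitz_on (cball 0 K) (hamiltonian A L x)"
    and control_lipschitz: "\<And>x. La-lipschitz_on (cball 0 K) (opt_control A L x)"
    and control_nonneg: "\<And>x p y. 0 \<le> opt_control A L x p $ y"
    and control_norm_le: "\<And>x p. norm (opt_control A L x p) \<le> R"
begin

text \<open>The coefficients of the differential inequality for the error: \<open>rate\<close> multiplies the size of the
error, \<open>residual\<close> multiplies \<open>1 / (N - 1)\<close>. The summand \<open>1\<close> only makes \<open>residual\<close> positive, as
required by the comparison lemma.\<close>

definition rate :: real where
  "rate = 2 * real CARD('d) * LH + 4 * c * (real CARD('d))\<^sup>2 * La"

definition residual :: real where
  "residual = 8 * c\<^sup>2 * (real CARD('d))\<^sup>2 * La + R * real CARD('d) * c + 1"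

lemma LH_nonneg: "0 \<le> LH" and La_nonneg: "0 \<le> La"
  using lipschitz_on_nonneg[OF H_lipschitz] lipschitz_on_nonneg[OF control_lipschitz] by auto

lemma rate_nonneg: "0 \<le> rate"
  unfolding rate_def using LH_nonneg La_nonneg c_nonneg by simp

lemma residual_pos: "0 < residual"
  unfolding residual_def using La_nonneg c_nonneg R_nonneg
  by (intro add_nonneg_pos add_nonneg_nonneg mult_nonneg_nonneg) auto

lemma control_dist_le:
  assumes "norm p \<le> K" "norm q \<le> K"
  shows "norm (opt_control A L x p - opt_control A L x q) \<le> La * norm (p - q)"
  using lipschitz_onD[OF control_lipschitz, of p q x] assms by (simp add: dist_norm)

lemma hamiltonian_dist_le:
  assumes "norm p \<le> K" "norm q \<le> K"
  shows "\<bar>hamiltonian A L x p - hamiltonian A L x q\<bar> \<le> LH * norm (p - q)"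
  using lipschitz_onD[OF H_lipschitz, of p q x] assms by (simp add: dist_norm)

text \<open>The influence of player \<open>j\<close> on player \<open>i\<close> in the \<open>N\<close>-player system against its share of the integral
term of the Master Equation. Two errors occur. The controls differ, by the error of player \<open>j\<close>'s own
finite difference and by the replacement of the measure seen by \<open>j\<close> with the one seen by \<open>i\<close>; this is
multiplied by the increment of \<open>mf_value\<close>, which is of order \<open>h\<close>. And the increment differs from its
linearisation by order \<open>h\<^sup>2\<close>. The factor \<open>h\<close> in front is what allows the sum over \<open>N - 1\<close> players.\<close>

lemma interaction_term_le:
  fixes x :: "nat \<Rightarrow> 'd"
  assumes N: "2 \<le> N" and i: "i \<in> {1..N}" and j: "j \<in> {1..N} - {i}" and t: "t \<in> {0..T}"
    and p: "norm p \<le> K"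
    and e: "norm (p - fin_diff_at j (mf_value U N j t) x) \<le> real CARD('d) * (2 * \<phi>)"
  defines "h \<equiv> 1 / (real N - 1)"
    and "m \<equiv> emp_measure_except N i x"
  shows "\<bar>opt_control A L (x j) p \<bullet> fin_diff_at j (mf_value U N i t) x
      - h * (D t (x i) m (x j) \<bullet> opt_control A L (x j) (fin_diff (\<lambda>y. U t y m) (x j)))\<bar>
    \<le> h * (4 * c * (real CARD('d))\<^sup>2 * La * \<phi> + (residual - 1) * h)"
proof -
  define d where "d = real CARD('d)"
  define m' where "m' = emp_measure_except N j x"
  define \<Delta> where "\<Delta> = fin_diff_at j (mf_value U N i t) x"
  define q where "q = fin_diff (\<lambda>y. U t y m) (x j)"
  define \<alpha> where "\<alpha> = opt_control A L (x j) p"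
  define \<beta> where "\<beta> = opt_control A L (x j) q"
  have j': "j \<in> {1..N}" using j by auto
  have h: "0 < h" using N by (simp add: h_def)
  have m: "m \<in> prob_simplex" and m': "m' \<in> prob_simplex"
    unfolding m_def m'_def by (intro emp_measure_except_in_simplex N i j')+
  have mass: "h \<le> m $ x j" unfolding h_def m_def by (rule emp_measure_except_ge[OF N i j])
  have \<Delta>_nth: "\<Delta> $ z = U t (x i) (m + h *\<^sub>R (axis z 1 - axis (x j) 1)) - U t (x i) m" for z
    unfolding \<Delta>_def h_def m_def by (rule fin_diff_at_mf_value_other[OF N i j])
  have \<Delta>_le: "norm \<Delta> \<le> d * (2 * c * h)"
    unfolding d_def
  proof (rule norm_le_card_mult)
    fix z
    have shifted: "m + h *\<^sub>R (axis z 1 - axis (x j) 1) \<in> prob_simplex"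
      using h mass by (intro simplex_transfer m) auto
    have "\<bar>\<Delta> $ z\<bar> \<le> c * l1_dist (m + h *\<^sub>R (axis z 1 - axis (x j) 1)) m"
      unfolding \<Delta>_nth by (rule U_lipschitz[OF t shifted m])
    also have "\<dots> \<le> c * (2 * h)"
      using h by (intro mult_left_mono c_nonneg
          l1_dist_scaled_le[OF _ axis_in_simplex[of z] axis_in_simplex[of "x j"]]) auto
    finally show "\<bar>\<Delta> $ z\<bar> \<le> 2 * c * h" by simp
  qed
  have taylor: "norm (\<Delta> - h *\<^sub>R D t (x i) m (x j)) \<le> d * (c * h\<^sup>2)"
    unfolding d_def
    using expansion[OF t m _ mass, of "x i"] h by (intro norm_le_card_mult) (simp add: \<Delta>_nth)
  \<comment> \<open>The prediction for \<open>j\<close> uses \<open>m'\<close>, the measure without \<open>j\<close>, while the Master Equation for player \<open>i\<close> evaluates the control of \<open>j\<close> at \<open>m\<close>.\<close>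
  have own: "fin_diff_at j (mf_value U N j t) x = fin_diff (\<lambda>y. U t y m') (x j)"
    unfolding m'_def by (rule fin_diff_at_mf_value_self[OF N j'])
  have "norm (fin_diff (\<lambda>y. U t y m') (x j) - q) \<le> d * (4 * c * h)"
    unfolding d_def
  proof (rule norm_le_card_mult)
    fix z
    have "l1_dist m' m \<le> 2 * h"
      unfolding m'_def m_def h_def by (rule l1_dist_emp_measure_except[OF N i j'])
    then have "\<bar>U t y m' - U t y m\<bar> \<le> c * (2 * h)" for y
      using U_lipschitz[OF t m' m, of y] mult_left_mono[OF _ c_nonneg, of "l1_dist m' m" "2 * h"]
      by linarith
    from this[of z] this[of "x j"]
    show "\<bar>(fin_diff (\<lambda>y. U t y m') (x j) - q) $ z\<bar> \<le> 4 * c * h"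
      by (simp add: q_def fin_diff_def)
  qed
  then have "norm (p - q) \<le> d * (2 * \<phi>) + d * (4 * c * h)"
    using e norm_triangle_ineq[of "p - fin_diff (\<lambda>y. U t y m') (x j)" "fin_diff (\<lambda>y. U t y m') (x j) - q"]
    unfolding own d_def by simp
  moreover have "norm (\<alpha> - \<beta>) \<le> La * norm (p - q)"
    unfolding \<alpha>_def \<beta>_def using p U_diff_le[OF t m] by (intro control_dist_le) (auto simp: q_def)
  ultimately have \<alpha>\<beta>: "norm (\<alpha> - \<beta>) \<le> La * (d * (2 * \<phi>) + d * (4 * c * h))"
    using mult_left_mono[OF _ La_nonneg] by (meson order_trans)
  have "\<bar>(\<alpha> - \<beta>) \<bullet> \<Delta>\<bar> \<le> norm (\<alpha> - \<beta>) * norm \<Delta>" by (rule Cauchy_Schwarz_ineq2)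
  also have "\<dots> \<le> (La * (d * (2 * \<phi>) + d * (4 * c * h))) * (d * (2 * c * h))"
    using \<alpha>\<beta> \<Delta>_le order_trans[OF norm_ge_zero \<alpha>\<beta>] by (intro mult_mono) auto
  finally have 1: "\<bar>(\<alpha> - \<beta>) \<bullet> \<Delta>\<bar> \<le> (La * (d * (2 * \<phi>) + d * (4 * c * h))) * (d * (2 * c * h))" .
  have "\<bar>\<beta> \<bullet> (\<Delta> - h *\<^sub>R D t (x i) m (x j))\<bar> \<le> norm \<beta> * norm (\<Delta> - h *\<^sub>R D t (x i) m (x j))"
    by (rule Cauchy_Schwarz_ineq2)
  also have "\<dots> \<le> R * (d * (c * h\<^sup>2))"
    using taylor R_nonneg by (intro mult_mono) (auto simp: \<beta>_def control_norm_le)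
  finally have 2: "\<bar>\<beta> \<bullet> (\<Delta> - h *\<^sub>R D t (x i) m (x j))\<bar> \<le> R * (d * (c * h\<^sup>2))" .
  have "\<alpha> \<bullet> \<Delta> - h * (D t (x i) m (x j) \<bullet> \<beta>)
      = (\<alpha> - \<beta>) \<bullet> \<Delta> + \<beta> \<bullet> (\<Delta> - h *\<^sub>R D t (x i) m (x j))"
    by (simp add: inner_diff_left inner_diff_right inner_commute)
  then have "\<bar>\<alpha> \<bullet> \<Delta> - h * (D t (x i) m (x j) \<bullet> \<beta>)\<bar>
      \<le> (La * (d * (2 * \<phi>) + d * (4 * c * h))) * (d * (2 * c * h)) + R * (d * (c * h\<^sup>2))"
    using 1 2 by linarith
  also have "\<dots> = h * (4 * c * d\<^sup>2 * La * \<phi> + (residual - 1) * h)"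
    by (simp add: residual_def d_def[symmetric] algebra_simps power2_eq_square)
  finally show ?thesis by (simp add: \<alpha>_def \<beta>_def \<Delta>_def q_def d_def)
qed

text \<open>Subtracting the Master Equation at \<open>(x i, m)\<close>, with \<open>m\<close> the measure seen by \<open>i\<close>, from the equation
of player \<open>i\<close>. The error then solves the backward equation of a Markov chain whose jump rates are the
optimal controls of the other players, up to a term bounded by the largest error and by \<open>1 / N\<close>.\<close>

lemma error_equation:
  fixes v :: "nat \<Rightarrow> real \<Rightarrow> (nat \<Rightarrow> 'd) \<Rightarrow> real"
  assumes N: "2 \<le> N" and hjb: "hjb_solution A L T F G N v"
    and v_diff_le: "\<And>i t x. \<lbrakk>i \<in> {1..N}; t \<in> {0..T}; x \<in> configs N\<rbrakk>
      \<Longrightarrow> norm (fin_diff_at i (v i t) x) \<le> K"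
    and i: "i \<in> {1..N}" and t: "t \<in> {0..T}" and x: "x \<in> configs N"
  defines "e \<equiv> \<lambda>i t x. v i t x - mf_value U N i t x"
  shows "\<exists>e'. ((\<lambda>s. e i s x) has_real_derivative e') (at t within {0..T}) \<and>
    (\<forall>\<phi>. (\<forall>j\<in>{1..N}. \<forall>y\<in>configs N. \<bar>e j t y\<bar> \<le> \<phi>) \<longrightarrow>
      \<bar>- e' - (\<Sum>j\<in>{1..N} - {i}. opt_control A L (x j) (fin_diff_at j (v j t) x) \<bullet> fin_diff_at j (e i t) x)\<bar>
      \<le> rate * \<phi> + residual * (1 / (real N - 1)))"
proof -
  define h where "h = 1 / (real N - 1)"
  define m where "m = emp_measure_except N i x"
  define \<alpha> where "\<alpha> = (\<lambda>j. opt_control A L (x j) (fin_diff_at j (v j t) x))"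
  define \<beta> where "\<beta> = (\<lambda>y. opt_control A L y (fin_diff (\<lambda>y'. U t y' m) y))"
  define u where "u = mf_value U N i t"
  have h: "0 < h" using N by (simp add: h_def)
  have m: "m \<in> prob_simplex" unfolding m_def by (rule emp_measure_except_in_simplex[OF N i])
  obtain v' where v': "((\<lambda>s. v i s x) has_real_derivative v') (at t within {0..T})"
    and v_eq: "- v' - (\<Sum>j\<in>{1..N} - {i}. \<alpha> j \<bullet> fin_diff_at j (v i t) x)
      + hamiltonian A L (x i) (fin_diff_at i (v i t) x) = F (x i) m"
    using hjb i t x unfolding hjb_solution_def m_def \<alpha>_def by blast
  obtain u' where u': "((\<lambda>s. U s (x i) m) has_real_derivative u') (at t within {0..T})"
    and u_eq: "- u' + hamiltonian A L (x i) (fin_diff (\<lambda>y. U t y m) (x i))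
      - (\<Sum>y\<in>UNIV. (D t (x i) m y \<bullet> \<beta> y) * m $ y) = F (x i) m"
    using classical t m unfolding classical_master_solution_def \<beta>_def by blast
  have integral: "(\<Sum>y\<in>UNIV. (D t (x i) m y \<bullet> \<beta> y) * m $ y)
      = (\<Sum>j\<in>{1..N} - {i}. h * (D t (x i) m (x j) \<bullet> \<beta> (x j)))"
    unfolding m_def h_def sum_distrib_left[symmetric] by (rule integral_emp_measure_except[OF N i])
  have own: "fin_diff_at i u x = fin_diff (\<lambda>y. U t y m) (x i)"
    unfolding m_def u_def by (rule fin_diff_at_mf_value_self[OF N i])
  have "((\<lambda>s. e i s x) has_real_derivative v' - u') (at t within {0..T})"
    unfolding e_def mf_value_def m_def[symmetric] by (intro DERIV_diff v' u')
  moreover have "\<bar>- (v' - u') - (\<Sum>j\<in>{1..N} - {i}. \<alpha> j \<bullet> fin_diff_at j (e i t) x)\<bar> \<le> rate * \<phi> + residual * h"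
    if \<phi>: "\<forall>j\<in>{1..N}. \<forall>y\<in>configs N. \<bar>e j t y\<bar> \<le> \<phi>" for \<phi>
  proof -
    have e_diff: "norm (fin_diff_at j (v j t) x - fin_diff_at j (mf_value U N j t) x)
        \<le> real CARD('d) * (2 * \<phi>)" if "j \<in> {1..N}" for j
      unfolding fin_diff_at_diff[symmetric]
      by (rule norm_fin_diff_at_le[OF _ x that]) (use \<phi> that in \<open>auto simp: e_def\<close>)
    define HV where "HV = hamiltonian A L (x i) (fin_diff_at i (v i t) x)"
    define HU where "HU = hamiltonian A L (x i) (fin_diff_at i u x)"
    have "- (v' - u') - (\<Sum>j\<in>{1..N} - {i}. \<alpha> j \<bullet> fin_diff_at j (e i t) x)
        = (\<Sum>j\<in>{1..N} - {i}. \<alpha> j \<bullet> fin_diff_at j u x - h * (D t (x i) m (x j) \<bullet> \<beta> (x j))) - (HV - HU)"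
      using v_eq u_eq unfolding integral own[symmetric] e_def fin_diff_at_diff u_def[symmetric]
        HV_def[symmetric] HU_def[symmetric] inner_diff_right sum_subtractf by linarith
    moreover have "\<bar>HV - HU\<bar> \<le> LH * (real CARD('d) * (2 * \<phi>))"
    proof -
      have "norm (fin_diff_at i u x) \<le> K" unfolding own by (rule U_diff_le[OF t m])
      then have "\<bar>HV - HU\<bar> \<le> LH * norm (fin_diff_at i (v i t) x - fin_diff_at i u x)"
        unfolding HV_def HU_def by (intro hamiltonian_dist_le v_diff_le i t x)
      also have "\<dots> \<le> LH * (real CARD('d) * (2 * \<phi>))"
        unfolding u_def by (intro mult_left_mono e_diff i LH_nonneg)
      finally show ?thesis .
    qed
    moreover have "\<bar>\<Sum>j\<in>{1..N} - {i}. \<alpha> j \<bullet> fin_diff_at j u x - h * (D t (x i) m (x j) \<bullet> \<beta> (x j))\<bar>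
        \<le> 4 * c * (real CARD('d))\<^sup>2 * La * \<phi> + (residual - 1) * h"
    proof -
      have "\<bar>\<alpha> j \<bullet> fin_diff_at j u x - h * (D t (x i) m (x j) \<bullet> \<beta> (x j))\<bar>
          \<le> h * (4 * c * (real CARD('d))\<^sup>2 * La * \<phi> + (residual - 1) * h)"
        if j: "j \<in> {1..N} - {i}" for j
        unfolding h_def m_def \<alpha>_def \<beta>_def u_def using j
        by (intro interaction_term_le N i t v_diff_le x e_diff) auto
      then have "\<bar>\<Sum>j\<in>{1..N} - {i}. \<alpha> j \<bullet> fin_diff_at j u x - h * (D t (x i) m (x j) \<bullet> \<beta> (x j))\<bar>
          \<le> (\<Sum>j\<in>{1..N} - {i}. h * (4 * c * (real CARD('d))\<^sup>2 * La * \<phi> + (residual - 1) * h))"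
        by (intro order_trans[OF sum_abs] sum_mono)
      \<comment> \<open>The \<open>N - 1\<close> interaction terms absorb one factor \<open>h = 1 / (N - 1)\<close>.\<close>
      also have "\<dots> = (real N - 1) * (h * (4 * c * (real CARD('d))\<^sup>2 * La * \<phi> + (residual - 1) * h))"
        using card_others[OF N i] by simp
      also have "\<dots> = 4 * c * (real CARD('d))\<^sup>2 * La * \<phi> + (residual - 1) * h"
        using N by (simp add: h_def)
      finally show ?thesis .
    qed
    ultimately have "\<bar>- (v' - u') - (\<Sum>j\<in>{1..N} - {i}. \<alpha> j \<bullet> fin_diff_at j (e i t) x)\<bar>
        \<le> LH * (real CARD('d) * (2 * \<phi>)) + (4 * c * (real CARD('d))\<^sup>2 * La * \<phi> + (residual - 1) * h)"
      by linarith
    also have "\<dots> = rate * \<phi> + (residual - 1) * h"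
      by (simp add: rate_def algebra_simps)
    also have "\<dots> \<le> rate * \<phi> + residual * h" using h by (simp add: left_diff_distrib)
    finally show ?thesis .
  qed
  ultimately show ?thesis unfolding \<alpha>_def h_def by blast
qed

text \<open>The maximum principle. At a player, a configuration and a sign \<open>\<sigma>\<close> where the signed error is largest,
every jump of another player can only decrease it; the jump rates being nonnegative, the transport
term has a favourable sign and \<open>backward_comparison\<close> applies, the error being zero at time \<open>T\<close>.\<close>

lemma hjb_close_to_mf_value:
  fixes v :: "nat \<Rightarrow> real \<Rightarrow> (nat \<Rightarrow> 'd) \<Rightarrow> real"
  assumes N: "2 \<le> N" and hjb: "hjb_solution A L T F G N v"
    and v_diff_le: "\<And>i t x. \<lbrakk>i \<in> {1..N}; t \<in> {0..T}; x \<in> configs N\<rbrakk>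
      \<Longrightarrow> norm (fin_diff_at i (v i t) x) \<le> K"
    and i: "i \<in> {1..N}" and t: "t \<in> {0..T}" and x: "x \<in> configs N"
  shows "\<bar>v i t x - mf_value U N i t x\<bar> \<le> 4 * residual * exp ((rate + 1) * T) / real N"
proof -
  define h where "h = 1 / (real N - 1)"
  define e where "e = (\<lambda>i t x. v i t x - mf_value U N i t x)"
  define flow where "flow = (\<lambda>i t x.
    \<Sum>j\<in>{1..N} - {i}. opt_control A L (x j) (fin_diff_at j (v j t) x) \<bullet> fin_diff_at j (e i t) x)"
  have h: "0 < h" "h \<le> 2 / real N" using N by (auto simp: h_def field_simps)
  have "\<forall>i\<in>{1..N}. \<forall>t\<in>{0..T}. \<forall>x\<in>configs N. \<exists>e'.
    ((\<lambda>s. e i s x) has_real_derivative e') (at t within {0..T}) \<and>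
    (\<forall>\<phi>. (\<forall>j\<in>{1..N}. \<forall>y\<in>configs N. \<bar>e j t y\<bar> \<le> \<phi>) \<longrightarrow> \<bar>- e' - flow i t x\<bar> \<le> rate * \<phi> + residual * h)"
    unfolding e_def flow_def h_def using error_equation[OF N hjb v_diff_le] by blast
  then obtain e' where
    e': "\<And>i t x. \<lbrakk>i \<in> {1..N}; t \<in> {0..T}; x \<in> configs N\<rbrakk>
      \<Longrightarrow> ((\<lambda>s. e i s x) has_real_derivative e' i t x) (at t within {0..T})"
    and bound: "\<And>i t x \<phi>. \<lbrakk>i \<in> {1..N}; t \<in> {0..T}; x \<in> configs N;
        \<forall>j\<in>{1..N}. \<forall>y\<in>configs N. \<bar>e j t y\<bar> \<le> \<phi>\<rbrakk>
      \<Longrightarrow> \<bar>- e' i t x - flow i t x\<bar> \<le> rate * \<phi> + residual * h"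
    by metis
  \<comment> \<open>Both signs are carried in the index, so that the maximum of the family is the largest absolute error.\<close>
  define I :: "(nat \<times> (nat \<Rightarrow> 'd) \<times> real) set" where "I = {1..N} \<times> configs N \<times> {1, -1}"
  have comparison: "(\<lambda>(i, x, \<sigma>) t. \<sigma> * e i t x) k t \<le> 2 * (residual * h) * exp ((rate + 1) * T)"
    if "k \<in> I" for k
  proof (rule backward_comparison[where I = I and f = "\<lambda>(i, x, \<sigma>) t. \<sigma> * e i t x"
        and f' = "\<lambda>(i, x, \<sigma>) t. \<sigma> * e' i t x"])
    show "finite I" unfolding I_def by (intro finite_SigmaI finite_configs) auto
    show "0 \<le> rate" by (rule rate_nonneg)
    show "0 < residual * h" using residual_pos h by simp
  next
    fix k s assume "k \<in> I" "s \<in> {0..T}"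
    then show "((\<lambda>(i, x, \<sigma>) t. \<sigma> * e i t x) k has_real_derivative (\<lambda>(i, x, \<sigma>) t. \<sigma> * e' i t x) k s)
        (at s within {0..T})"
      by (auto simp: I_def intro!: DERIV_cmult e')
  next
    fix k assume "k \<in> I"
    moreover have "e i T x = 0" if "i \<in> {1..N}" "x \<in> configs N" for i x
      using hjb classical that emp_measure_except_in_simplex[OF N that(1), of x]
      unfolding hjb_solution_def classical_master_solution_def e_def mf_value_def by simp
    ultimately show "(\<lambda>(i, x, \<sigma>) t. \<sigma> * e i t x) k T \<le> 0" by (auto simp: I_def)
  next
    fix k s assume k: "k \<in> I" and s: "s \<in> {0..T}"
      and max: "\<And>l. l \<in> I \<Longrightarrow> (\<lambda>(i, x, \<sigma>) t. \<sigma> * e i t x) l s \<le> (\<lambda>(i, x, \<sigma>) t. \<sigma> * e i t x) k s"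
    obtain i x \<sigma> where k_eq: "k = (i, x, \<sigma>)" and i: "i \<in> {1..N}" and x: "x \<in> configs N"
      and \<sigma>: "\<sigma> = 1 \<or> \<sigma> = -1"
      using k by (auto simp: I_def)
    define \<phi> where "\<phi> = \<sigma> * e i s x"
    have le: "\<tau> * e j s y \<le> \<phi>" if "j \<in> {1..N}" "y \<in> configs N" "\<tau> \<in> {1, -1}" for j y \<tau>
      using max[of "(j, y, \<tau>)"] that by (auto simp: I_def k_eq \<phi>_def)
    have "\<bar>e j s y\<bar> \<le> \<phi>" if "j \<in> {1..N}" "y \<in> configs N" for j y
      using le[OF that, of 1] le[OF that, of "-1"] by (simp add: abs_le_iff)
    then have "\<bar>- e' i s x - flow i s x\<bar> \<le> rate * \<phi> + residual * h"
      by (intro bound i s x) auto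
    moreover have "\<sigma> * flow i s x \<le> 0"
    proof -
      have "\<sigma> * (opt_control A L (x j) (fin_diff_at j (v j s) x) \<bullet> fin_diff_at j (e i s) x) \<le> 0"
        if j: "j \<in> {1..N} - {i}" for j
      proof -
        have "\<sigma> * (fin_diff_at j (e i s) x $ y) \<le> 0" for y
          using le[OF i fun_upd_in_configs[OF x, of j y], of \<sigma>] j \<sigma>
          by (auto simp: fin_diff_at_def \<phi>_def right_diff_distrib)
        then have "(\<Sum>y\<in>UNIV. opt_control A L (x j) (fin_diff_at j (v j s) x) $ y
            * (\<sigma> * (fin_diff_at j (e i s) x $ y))) \<le> 0"
          by (intro sum_nonpos mult_nonneg_nonpos[OF control_nonneg]) blast
        then show ?thesis
          by (simp add: inner_vec_def sum_distrib_left mult.left_commute)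
      qed
      then show ?thesis unfolding flow_def sum_distrib_left by (intro sum_nonpos)
    qed
    ultimately have "- (\<sigma> * e' i s x) \<le> rate * \<phi> + residual * h" using \<sigma> by (auto simp: abs_le_iff)
    then show "- (\<lambda>(i, x, \<sigma>) t. \<sigma> * e' i t x) k s
        \<le> rate * (\<lambda>(i, x, \<sigma>) t. \<sigma> * e i t x) k s + residual * h"
      by (simp add: k_eq \<phi>_def)
  qed (use that t in auto)
  have "\<bar>e i t x\<bar> \<le> 2 * (residual * h) * exp ((rate + 1) * T)"
    using comparison[of "(i, x, 1)"] comparison[of "(i, x, -1)"] i x
    by (auto simp: I_def abs_le_iff)
  also have "\<dots> = h * (2 * residual * exp ((rate + 1) * T))" by simp
  also have "\<dots> \<le> (2 / real N) * (2 * residual * exp ((rate + 1) * T))"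
    using h residual_pos by (intro mult_right_mono) auto
  finally show ?thesis by (simp add: e_def)
qed

lemma hjb_close_to_master_solution:
  fixes v :: "nat \<Rightarrow> real \<Rightarrow> (nat \<Rightarrow> 'd) \<Rightarrow> real"
  assumes N: "2 \<le> N" and i: "i \<in> {1..N}" and t: "t \<in> {0..T}"
    and close: "\<bar>v i t x - mf_value U N i t x\<bar> \<le> E / real N"
  shows "\<bar>v i t x - U t (x i) (emp_measure N x)\<bar> \<le> (E + 2 * c) / real N"
proof -
  let ?m = "emp_measure_except N i x"
  have "\<bar>U t (x i) (emp_measure N x) - U t (x i) ?m\<bar> \<le> c * l1_dist (emp_measure N x) ?m"
  proof (rule U_lipschitz[OF t])
    show "?m \<in> prob_simplex" by (rule emp_measure_except_in_simplex[OF N i])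
    show "emp_measure N x \<in> prob_simplex"
      by (rule emp_measure_in_simplex) (use N in auto)
  qed
  also have "\<dots> \<le> c * (2 / real N)"
    by (intro mult_left_mono l1_dist_emp_measure[OF N i] c_nonneg)
  finally show ?thesis using close by (simp add: mf_value_def add_divide_distrib mult.commute)
qed

text \<open>Averaging over independent states of law \<open>m\<close> costs the distance between the empirical measure and \<open>m\<close>,
whose mean is of order \<open>1 / sqrt N\<close> and dominates the \<open>1 / N\<close> error of the values.\<close>

lemma w_average_close_to_master_solution:
  fixes v :: "nat \<Rightarrow> real \<Rightarrow> (nat \<Rightarrow> 'd) \<Rightarrow> real"
  assumes N: "2 \<le> N" and i: "i \<in> {1..N}" and t: "t \<in> {0..T}" and m: "m \<in> prob_simplex"
    and close: "\<And>y. y \<in> configs N \<Longrightarrow> \<bar>v i t y - mf_value U N i t y\<bar> \<le> E / real N"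
    and E: "0 \<le> E"
  shows "\<bar>w_average N v i t z m - U t z m\<bar> \<le> (E + 2 * c * real CARD('d)) / sqrt (real N)"
proof -
  define J where "J = {1..N} - {i}"
  define \<Xi> where "\<Xi> = (J \<rightarrow>\<^sub>E UNIV :: (nat \<Rightarrow> 'd) set)"
  define P where "P = (\<lambda>\<xi>. \<Prod>j\<in>J. m $ \<xi> j)"
  have P: "0 \<le> P \<xi>" for \<xi> unfolding P_def using simplex_nonneg[OF m] by (intro prod_nonneg) auto
  have P_sum: "(\<Sum>\<xi>\<in>\<Xi>. P \<xi>) = 1"
    unfolding P_def \<Xi>_def by (rule product_weights_sum[OF _ m]) (simp add: J_def)
  have point: "\<bar>v i t (\<xi>(i := z)) - U t z m\<bar> \<le> E / real N + c * l1_dist (emp_measure_except N i \<xi>) m"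
    if "\<xi> \<in> \<Xi>" for \<xi>
  proof -
    have "\<xi>(i := z) \<in> configs N"
      using that i by (auto simp: \<Xi>_def J_def configs_def PiE_iff extensional_def)
    from close[OF this] have "\<bar>v i t (\<xi>(i := z)) - U t z (emp_measure_except N i \<xi>)\<bar> \<le> E / real N"
      by (simp add: mf_value_def emp_measure_except_update_self[OF N i])
    moreover have "\<bar>U t z (emp_measure_except N i \<xi>) - U t z m\<bar> \<le> c * l1_dist (emp_measure_except N i \<xi>) m"
      by (intro U_lipschitz t m emp_measure_except_in_simplex[OF N i])
    ultimately show ?thesis by linarith
  qed
  have "w_average N v i t z m - U t z m
      = (\<Sum>\<xi>\<in>\<Xi>. v i t (\<xi>(i := z)) * P \<xi>) - U t z m * (\<Sum>\<xi>\<in>\<Xi>. P \<xi>)"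
    using P_sum by (simp add: w_average_def P_def J_def \<Xi>_def)
  also have "\<dots> = (\<Sum>\<xi>\<in>\<Xi>. P \<xi> * (v i t (\<xi>(i := z)) - U t z m))"
    unfolding sum_distrib_left sum_subtractf[symmetric] by (simp add: algebra_simps)
  also have "\<bar>\<dots>\<bar> \<le> (\<Sum>\<xi>\<in>\<Xi>. P \<xi> * (E / real N + c * l1_dist (emp_measure_except N i \<xi>) m))"
    using point P by (intro order_trans[OF sum_abs] sum_mono) (auto simp: abs_mult mult_left_mono)
  also have "\<dots> = (\<Sum>\<xi>\<in>\<Xi>. P \<xi>) * (E / real N)
      + c * (\<Sum>\<xi>\<in>\<Xi>. P \<xi> * l1_dist (emp_measure_except N i \<xi>) m)"
    unfolding sum_distrib_left sum_distrib_right sum.distrib[symmetric] by (simp add: algebra_simps)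
  also have "\<dots> \<le> 1 * (E / real N) + c * (real CARD('d) / sqrt (real N - 1))"
    unfolding P_sum unfolding P_def \<Xi>_def J_def
    by (intro add_mono mult_left_mono expected_empirical_distance N i m c_nonneg) auto
  also have "\<dots> \<le> E / sqrt (real N) + c * (real CARD('d) * (2 / sqrt (real N)))"
  proof (intro add_mono mult_left_mono c_nonneg)
    have "sqrt (real N) \<le> real N"
      using N real_sqrt_le_iff[of "real N" "(real N)\<^sup>2"] by (simp add: power2_eq_square)
    then show "1 * (E / real N) \<le> E / sqrt (real N)"
      using N E by (simp add: divide_left_mono)
    \<comment> \<open>\<open>N \<le> 4 (N - 1)\<close> since \<open>N \<ge> 2\<close>.\<close>
    have "sqrt (real N) \<le> sqrt (4 * (real N - 1))" using N by simp
    then have "sqrt (real N) \<le> 2 * sqrt (real N - 1)"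
      by (simp only: real_sqrt_mult real_sqrt_four)
    then have "1 / sqrt (real N - 1) \<le> 2 / sqrt (real N)"
      using N by (simp add: field_simps)
    then have "real CARD('d) * (1 / sqrt (real N - 1)) \<le> real CARD('d) * (2 / sqrt (real N))"
      by (rule mult_left_mono) simp
    then show "real CARD('d) / sqrt (real N - 1) \<le> real CARD('d) * (2 / sqrt (real N))" by simp
  qed
  finally show ?thesis by (simp add: add_divide_distrib mult_ac)
qed

end

lemma L1_dist_le:
  assumes m: "m \<in> prob_simplex" and "\<And>x. \<bar>f x - g x\<bar> \<le> r"
  shows "L1_dist m f g \<le> r"
proof -
  have "L1_dist m f g \<le> (\<Sum>x\<in>UNIV. r * m $ x)"
    unfolding L1_dist_def by (intro sum_mono mult_right_mono assms simplex_nonneg[OF m])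
  then show ?thesis using simplex_sum[OF m] by (simp flip: sum_distrib_left)
qed

lemma lipschitz_on_uniform_constant:
  fixes f :: "'a::finite \<Rightarrow> 'b::metric_space \<Rightarrow> 'c::metric_space"
  assumes "\<And>x. \<exists>B. B-lipschitz_on S (f x)"
  shows "\<exists>B. \<forall>x. B-lipschitz_on S (f x)"
proof -
  obtain B where B: "\<And>x. (B x)-lipschitz_on S (f x)" using assms by metis
  have "(MAX x. B x)-lipschitz_on S (f x)" for x
    by (rule lipschitz_on_mono[OF B order_refl]) auto
  then show ?thesis by blast
qed

theorem theorem1:
  fixes T \<kappa> M K :: real
    and A :: "(real ^ 'd::finite) set"
    and L F G :: "'d \<Rightarrow> real ^ 'd \<Rightarrow> real"
    and U :: "real \<Rightarrow> 'd \<Rightarrow> real ^ 'd \<Rightarrow> real"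
  assumes T_pos: "0 < T"
    and kappa_M: "0 < \<kappa>" "\<kappa> < M"
    and A_eq: "A = control_set \<kappa> M"
    and L_cont: "\<And>x. continuous_on A (L x)"
    and unique_maximizer: "\<And>x p. \<exists>!a. is_maximizer A L x p a"
    and U_regular: "regular_master_solution A L T F G U"
    and U_unique: "\<And>V t x m. \<lbrakk>regular_master_solution A L T F G V; t \<in> {0..T}; m \<in> prob_simplex\<rbrakk>
          \<Longrightarrow> V t x m = U t x m"
    and K_pos: "0 < K"
    and K_bounds_U: "\<And>t x m. \<lbrakk>t \<in> {0..T}; m \<in> prob_simplex\<rbrakk>
          \<Longrightarrow> norm (fin_diff (\<lambda>y. U t y m) x) \<le> K"
    and K_bounds_v: "\<And>N v i t x. \<lbrakk>2 \<le> N; hjb_solution A L T F G N v; i \<in> {1..N}; t \<in> {0..T};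
          x \<in> configs N\<rbrakk> \<Longrightarrow> norm (fin_diff_at i (v i t) x) \<le> K"
    and H1_hamiltonian: "\<And>x. \<exists>B. B-lipschitz_on (cball 0 K) (hamiltonian A L x)"
    and H1_opt_control: "\<And>x. \<exists>B. B-lipschitz_on (cball 0 K) (opt_control A L x)"
  shows "\<exists>C. \<forall>N\<ge>2. \<forall>v. hjb_solution A L T F G N v \<longrightarrow>
    (\<forall>t0\<in>{0..T}. \<forall>m0\<in>prob_simplex. \<forall>x\<in>configs N.
      (1 / real N) * (\<Sum>i\<in>{1..N}. \<bar>v i t0 x - U t0 (x i) (emp_measure N x)\<bar>) \<le> C / real N \<and>
      (\<forall>i\<in>{1..N}.
        L1_dist m0 (\<lambda>y. w_average N v i t0 y m0) (\<lambda>y. U t0 y m0) \<le> C / sqrt (real N)))"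
proof -
  obtain c D where c: "0 \<le> c" "classical_master_solution A L T F G U D"
    "\<And>t x m y z h. \<lbrakk>t \<in> {0..T}; m \<in> prob_simplex; 0 \<le> h; h \<le> m $ y\<rbrakk>
      \<Longrightarrow> \<bar>U t x (m + h *\<^sub>R (axis z 1 - axis y 1)) - U t x m - h * D t x m y $ z\<bar> \<le> c * h\<^sup>2"
    "\<And>t x m m'. \<lbrakk>t \<in> {0..T}; m \<in> prob_simplex; m' \<in> prob_simplex\<rbrakk>
      \<Longrightarrow> \<bar>U t x m - U t x m'\<bar> \<le> c * l1_dist m m'"
    using regular_solution_estimates[OF U_regular] by blast
  obtain LH where LH: "\<And>x. LH-lipschitz_on (cball 0 K) (hamiltonian A L x)"
    using lipschitz_on_uniform_constant[of "cball 0 K" "hamiltonian A L", OF H1_hamiltonian] by blast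
  obtain La where La: "\<And>x. La-lipschitz_on (cball 0 K) (opt_control A L x)"
    using lipschitz_on_uniform_constant[of "cball 0 K" "opt_control A L", OF H1_opt_control] by blast
  have control: "\<kappa> \<le> opt_control A L x p $ y" "opt_control A L x p $ y \<le> M" for x p y
  proof -
    have "is_maximizer A L x p (opt_control A L x p)"
      unfolding opt_control_def by (rule theI'[OF unique_maximizer])
    then show "\<kappa> \<le> opt_control A L x p $ y" "opt_control A L x p $ y \<le> M"
      by (auto simp: is_maximizer_def A_eq control_set_def)
  qed
  interpret master_setting T K c LH La "real CARD('d) * M" A L F G U D
  proof
    show "0 \<le> opt_control A L x p $ y" for x p y
      using control(1)[of x p y] kappa_M by linarith
    have "\<bar>opt_control A L x p $ y\<bar> \<le> M" for x p y
      using control[of x p y] kappa_M by linarith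
    then show "norm (opt_control A L x p) \<le> real CARD('d) * M" for x p
      by (rule norm_le_card_mult)
  qed (use kappa_M c LH La K_bounds_U in auto)
  define E where "E = 4 * residual * exp ((rate + 1) * T)"
  define C where "C = E + 2 * c * real CARD('d)"
  have E: "0 \<le> E" using residual_pos by (simp add: E_def)
  \<comment> \<open>\<open>C\<close> serves both estimates, whose constants are \<open>E + 2 * c\<close> and \<open>E + 2 * c * CARD('d)\<close>.\<close>
  have "1 \<le> real CARD('d)" by (simp add: Suc_leI)
  then have "2 * c * 1 \<le> 2 * c * real CARD('d)" using c(1) by (intro mult_left_mono) auto
  then have EC: "E + 2 * c \<le> C" by (simp add: C_def)
  show ?thesis
  proof (intro exI[of _ C] allI impI ballI conjI)
    fix N v t0 and m0 :: "real ^ 'd" and x :: "nat \<Rightarrow> 'd"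
    assume N: "2 \<le> N" and hjb: "hjb_solution A L T F G N v" and t0: "t0 \<in> {0..T}"
      and m0: "m0 \<in> prob_simplex" and x: "x \<in> configs N"
    have close: "\<bar>v i t0 y - mf_value U N i t0 y\<bar> \<le> E / real N"
      if "i \<in> {1..N}" "y \<in> configs N" for i y
      unfolding E_def by (rule hjb_close_to_mf_value[OF N hjb K_bounds_v[OF N hjb] that(1) t0 that(2)])
    have "(\<Sum>i\<in>{1..N}. \<bar>v i t0 x - U t0 (x i) (emp_measure N x)\<bar>) \<le> (\<Sum>i\<in>{1..N}. C / real N)"
    proof (intro sum_mono)
      fix i assume i: "i \<in> {1..N}"
      have "\<bar>v i t0 x - U t0 (x i) (emp_measure N x)\<bar> \<le> (E + 2 * c) / real N"
        by (rule hjb_close_to_master_solution[where v = v, OF N i t0 close[OF i x]])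
      also have "\<dots> \<le> C / real N" using EC by (intro divide_right_mono) auto
      finally show "\<bar>v i t0 x - U t0 (x i) (emp_measure N x)\<bar> \<le> C / real N" .
    qed
    then have "(\<Sum>i\<in>{1..N}. \<bar>v i t0 x - U t0 (x i) (emp_measure N x)\<bar>) \<le> C" using N by simp
    then show "(1 / real N) * (\<Sum>i\<in>{1..N}. \<bar>v i t0 x - U t0 (x i) (emp_measure N x)\<bar>) \<le> C / real N"
      by (simp add: divide_right_mono)
    show "L1_dist m0 (\<lambda>y. w_average N v i t0 y m0) (\<lambda>y. U t0 y m0) \<le> C / sqrt (real N)"
      if i: "i \<in> {1..N}" for i
      unfolding C_def
      by (intro L1_dist_le[OF m0] w_average_close_to_master_solution[where v = v,
          OF N i t0 m0 close[OF i] E])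
  qed
qed

end
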